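(* Let $\Phi$ be a uniformly absolutely convergent interaction on $X=E^{\mathbb{Z}}$ ($E$ finite). Assume: (1) $\Phi$ satisfies the Dobrushin condition $\bar c(\Phi)<1$; (2) $\sum_{k=1}^\infty\|\underline\delta(\Phi_{\Lambda_k})\|_2^2<\infty$; (3) $\sum_{k=1}^\infty\rho_k<\infty$, where $\rho_k:=\sup_{n\in\mathbb{N}}\big|\int_X\Phi_{\Lambda_k}d\nu^{(n)}\big|$. Then $\Psi^{(0)}$ has a unique Gibbs measure, and the family $\{f^{(k)}:k\in\mathbb{N}\}$, $f^{(k)}=\frac{d\nu^{(k)}}{d\nu^{(0)}}$, is uniformly integrable in $L^1(\nu^{(0)})$.
   Context: An interaction $\Phi=(\Phi_\Lambda)_{\Lambda\Subset\mathbb{Z}}$ consists of functions $\Phi_\Lambda$ on $X$ depending only on coordinates in $\Lambda$; UAC means $\sup_i\sum_{V\ni i}\|\Phi_V\|_\infty<\infty$. Gibbs measures for $\Phi$ are probabilities consistent with $\gamma^\Phi_\Lambda(\omega_\Lambda|\eta_{\Lambda^c})=e^{-H^\Phi_\Lambda(\omega_\Lambda\eta_{\Lambda^c})}/\sum_{\bar\omega_\Lambda}e^{-H^\Phi_\Lambda(\bar\omega_\Lambda\eta_{\Lambda^c})}$, $H^\Phi_\Lambda=\sum_{V\cap\Lambda\ne\emptyset}\Phi_V$. Dobrushin condition: $\bar c(\Phi)=\frac12\sup_i\sum_{\Lambda\ni i}(|\Lambda|-1)\delta(\Phi_\Lambda)<1$, $\delta(f)=\sup_{\xi,\eta}|f(\xi)-f(\eta)|$.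 For $F:X\to\mathbb{R}$ and $k\in\mathbb{Z}$, $\delta_kF=\sup\{F(\xi)-F(\eta):\xi_j=\eta_j\ \forall j\ne k\}$ and $\|\underline\delta(F)\|_2^2=\sum_{k\in\mathbb{Z}}(\delta_kF)^2$. Let $\mathcal A=\{\Lambda\Subset\mathbb{Z}:\min\Lambda<0\le\max\Lambda\}=\{\Lambda_1,\Lambda_2,\dots\}$ (fixed arbitrary enumeration) and, for $k\ge0$, $\Psi^{(k)}_\Lambda=0$ if $\Lambda\in\{\Lambda_i:i\ge k+1\}$, $\Psi^{(k)}_\Lambda=\Phi_\Lambda$ otherwise. Under the Dobrushin condition on $\Phi$, each $\Psi^{(k)}$ has a unique Gibbs measure $\nu^{(k)}$ and $\nu^{(k)}\ll\nu^{(0)}$. *)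

theory Defs
  imports "HOL-Probability.Probability"
begin

text \<open>Configurations: X = E^Z with E a finite type; sites are integers.
  Interactions are maps from subsets of Z to real functions on X; only finite
  subsets are ever used.\<close>

type_synonym 'e config = "int \<Rightarrow> 'e"
type_synonym 'e interaction = "int set \<Rightarrow> 'e config \<Rightarrow> real"

definition cfgM :: "('e::finite) config measure" where
  "cfgM = PiM UNIV (\<lambda>_::int. count_space (UNIV::'e set))"

definition interaction :: "('e::finite) interaction \<Rightarrow> bool" where
  "interaction \<Phi> \<longleftrightarrow> (\<forall>\<Lambda>. finite \<Lambda> \<longrightarrow>
      (\<forall>\<xi> \<eta>. (\<forall>i\<in>\<Lambda>. \<xi> i = \<eta> i) \<longrightarrow> \<Phi> \<Lambda> \<xi> = \<Phi> \<Lambda> \<eta>))"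

definition sup_norm :: "('e config \<Rightarrow> real) \<Rightarrow> real" where
  "sup_norm f = (SUP \<xi>. \<bar>f \<xi>\<bar>)"

definition osc :: "('e config \<Rightarrow> real) \<Rightarrow> real" where
  "osc f = (SUP p. \<bar>f (fst p) - f (snd p)\<bar>)"

definition UAC :: "('e::finite) interaction \<Rightarrow> bool" where
  "UAC \<Phi> \<longleftrightarrow> (SUP i::int. infsum (\<lambda>V. ennreal (sup_norm (\<Phi> V))) {V. finite V \<and> i \<in> V}) < \<top>"

definition dobrushin_c :: "('e::finite) interaction \<Rightarrow> ennreal" where
  "dobrushin_c \<Phi> = (1/2) * (SUP i::int. infsum
      (\<lambda>\<Lambda>. ennreal ((real (card \<Lambda>) - 1) * osc (\<Phi> \<Lambda>))) {\<Lambda>. finite \<Lambda> \<and> i \<in> \<Lambda>})"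

definition delta_k :: "int \<Rightarrow> ('e config \<Rightarrow> real) \<Rightarrow> real" where
  "delta_k k F = Sup {F \<xi> - F \<eta> | \<xi> \<eta>. \<forall>j. j \<noteq> k \<longrightarrow> \<xi> j = \<eta> j}"

definition delta_norm2_sq :: "('e config \<Rightarrow> real) \<Rightarrow> ennreal" where
  "delta_norm2_sq F = infsum (\<lambda>k::int. ennreal ((delta_k k F)^2)) UNIV"

definition hamiltonian :: "('e::finite) interaction \<Rightarrow> int set \<Rightarrow> 'e config \<Rightarrow> real" where
  "hamiltonian \<Phi> \<Lambda> \<omega> = infsum (\<lambda>V. \<Phi> V \<omega>) {V. finite V \<and> V \<inter> \<Lambda> \<noteq> {}}"

definition agree_out :: "int set \<Rightarrow> 'e config \<Rightarrow> 'e config set" where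
  "agree_out \<Lambda> \<eta> = {\<omega>. \<forall>j. j \<notin> \<Lambda> \<longrightarrow> \<omega> j = \<eta> j}"

definition gibbs_kernel :: "('e::finite) interaction \<Rightarrow> int set \<Rightarrow> 'e config set \<Rightarrow> 'e config \<Rightarrow> real" where
  "gibbs_kernel \<Phi> \<Lambda> A \<eta> =
     (\<Sum>\<omega>\<in>agree_out \<Lambda> \<eta>. indicator A \<omega> * exp (- hamiltonian \<Phi> \<Lambda> \<omega>))
     / (\<Sum>\<omega>\<in>agree_out \<Lambda> \<eta>. exp (- hamiltonian \<Phi> \<Lambda> \<omega>))"

definition gibbs :: "('e::finite) interaction \<Rightarrow> 'e config measure \<Rightarrow> bool" where
  "gibbs \<Phi> \<mu> \<longleftrightarrow> prob_space \<mu> \<and> sets \<mu> = sets cfgM \<and>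
     (\<forall>\<Lambda>. finite \<Lambda> \<longrightarrow> (\<forall>A\<in>sets cfgM.
        measure \<mu> A = (\<integral>\<eta>. gibbs_kernel \<Phi> \<Lambda> A \<eta> \<partial>\<mu>)))"

definition crossing :: "int set set" where
  "crossing = {\<Lambda>. finite \<Lambda> \<and> \<Lambda> \<noteq> {} \<and> Min \<Lambda> < 0 \<and> 0 \<le> Max \<Lambda>}"

text \<open>Psi^(k): remove Lambda_i for i >= k+1 (enumeration Lambda_1, Lambda_2, ...)\<close>
definition psi :: "('e::finite) interaction \<Rightarrow> (nat \<Rightarrow> int set) \<Rightarrow> nat \<Rightarrow> 'e interaction" where
  "psi \<Phi> enum k \<Lambda> = (if \<Lambda> \<in> enum ` {k+1..} then (\<lambda>_. 0) else \<Phi> \<Lambda>)"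

definition nu :: "('e::finite) interaction \<Rightarrow> (nat \<Rightarrow> int set) \<Rightarrow> nat \<Rightarrow> 'e config measure" where
  "nu \<Phi> enum k = (THE \<mu>. gibbs (psi \<Phi> enum k) \<mu>)"

definition rho :: "('e::finite) interaction \<Rightarrow> (nat \<Rightarrow> int set) \<Rightarrow> nat \<Rightarrow> real" where
  "rho \<Phi> enum k = (SUP n. \<bar>\<integral>x. \<Phi> (enum k) x \<partial>(nu \<Phi> enum n)\<bar>)"

definition unif_integrable :: "'a measure \<Rightarrow> ('i \<Rightarrow> 'a \<Rightarrow> ennreal) \<Rightarrow> bool" where
  "unif_integrable \<mu> f \<longleftrightarrow>
     ((\<lambda>M::real. SUP k. \<integral>\<^sup>+ x. f k x * indicator {x. ennreal M < f k x} x \<partial>\<mu>) \<longlongrightarrow> 0) at_top"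

end

theory Submission
  imports Defs
begin

text \<open>
  Each \<open>psi \<Phi> enum k\<close> satisfies the Dobrushin condition, so it has exactly one Gibbs measure:
  updating one site \<open>i\<close> by its conditional law removes the oscillation \<open>v i\<close> at \<open>i\<close> and spreads at most
  \<open>c * v i\<close> of it over the other sites, \<open>c < 1\<close>, so repeated sweeps make every local observable
  almost constant.

  As \<open>psi \<Phi> enum k\<close> and \<open>psi \<Phi> enum 0\<close> differ by finitely many potentials with sum \<open>h\<close>, the measure
  \<open>exp (- h) / Z\<close> times \<open>nu 0\<close> is Gibbs for \<open>psi \<Phi> enum k\<close>, hence equal to \<open>nu k\<close>. Its relative
  entropy is \<open>- \<integral>h d(nu k) - ln Z\<close>, and by Jensen \<open>- ln Z \<le> \<integral>h d(nu 0)\<close>, so it is at most twice the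
  sum of the \<open>rho k\<close>. Bounded entropy of the densities gives uniform integrability.
\<close>

section \<open>Finite Boltzmann averages\<close>

text \<open>The factor 1/2 in \<open>dobrushin_c\<close> leaves no room for a crude estimate of how
  the conditional law at one site reacts to the others. A change of boundary moves differences of
  energies by up to twice the summed oscillations of the affected potentials, and a covariance is at
  most a quarter of the product of the two oscillations. Together this is half the summed
  oscillations, so the fraction of oscillation passed on is at most \<open>dob_c\<close>. Almost
  constant sweeps give existence as well as uniqueness. Averages over a large window do not change
  when a sweep inside it is inserted, so they form a Cauchy sequence, and their limits on cylinders
  extend to a measure. The obstacle is the Gibbs equation: the conditional average of a local
  function may depend on infinitely many sites. \<open>UAC\<close> makes it a uniform limit of local
  functions, so the equation survives the limit. Since \<open>nu\<close> is a definite description,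
  existence and uniqueness must hold for every \<open>k\<close> before anything can be said about
  it. The supremum over all \<open>n\<close> in \<open>rho\<close> is what controls the perturbation
  energy under both \<open>nu 0\<close> and \<open>nu k\<close>.\<close>

text \<open>Each factor contributes a half: a function stays within half its range of the midpoint,
  and its mean absolute deviation is also at most half its range, with equality for two equal atoms
  at the ends.\<close>

lemma covariance_le_oscillations:
  fixes p g h :: "'a \<Rightarrow> real"
  assumes "finite X" "\<And>x. x \<in> X \<Longrightarrow> 0 \<le> p x" "sum p X = 1"
    and g: "\<And>x y. x \<in> X \<Longrightarrow> y \<in> X \<Longrightarrow> \<bar>g x - g y\<bar> \<le> d"
    and h: "\<And>x y. x \<in> X \<Longrightarrow> y \<in> X \<Longrightarrow> \<bar>h x - h y\<bar> \<le> b"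
  shows "\<bar>(\<Sum>x\<in>X. p x * (g x * h x)) - (\<Sum>x\<in>X. p x * g x) * (\<Sum>x\<in>X. p x * h x)\<bar> \<le> b * d / 4"
proof -
  have ne: "X \<noteq> {}" using assms(3) by auto
  define m where "m = (\<Sum>x\<in>X. p x * h x)"
  define \<alpha> \<beta> where "\<alpha> = Min (h ` X)" and "\<beta> = Max (h ` X)"
  have hb: "\<alpha> \<le> h x" "h x \<le> \<beta>" if "x \<in> X" for x
    using that assms(1) by (auto simp: \<alpha>_def \<beta>_def)
  have range_le: "Max (q ` X) - Min (q ` X) \<le> c"
    if "\<And>x y. x \<in> X \<Longrightarrow> y \<in> X \<Longrightarrow> \<bar>q x - q y\<bar> \<le> c" for q :: "'a \<Rightarrow> real" and c
  proof -
    have "Max (q ` X) \<in> q ` X" "Min (q ` X) \<in> q ` X" using assms(1) ne by (auto intro!: Max_in Min_in)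
    then obtain x y where "x \<in> X" "y \<in> X" "Max (q ` X) = q x" "Min (q ` X) = q y" by blast
    with that[of x y] show ?thesis by linarith
  qed
  have ba: "\<beta> - \<alpha> \<le> b" unfolding \<alpha>_def \<beta>_def using h by (rule range_le)
  have gb: "Max (g ` X) - Min (g ` X) \<le> d" using g by (rule range_le)
  \<comment> \<open>Any constant may be subtracted from \<open>g\<close>, because
    \<open>h - m\<close> has mean zero. The midpoint of the range makes the supremum of the
    remainder as small as possible.\<close>
  define c where "c = (Max (g ` X) + Min (g ` X)) / 2"
  have gc: "\<bar>g x - c\<bar> \<le> d / 2" if "x \<in> X" for x
  proof -
    have "Min (g ` X) \<le> g x" "g x \<le> Max (g ` X)" using that assms(1) by auto
    then show ?thesis using gb unfolding c_def by (simp add: abs_le_iff field_simps)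
  qed
  have d0: "0 \<le> d" using g ne by (metis abs_ge_zero ex_in_conv order_trans)
  have m1: "\<alpha> \<le> m" "m \<le> \<beta>"
  proof -
    have "(\<Sum>x\<in>X. p x * \<alpha>) \<le> m" "m \<le> (\<Sum>x\<in>X. p x * \<beta>)"
      unfolding m_def using assms(2) hb by (auto intro!: sum_mono mult_left_mono)
    then show "\<alpha> \<le> m" "m \<le> \<beta>" using assms(3) by (simp_all flip: sum_distrib_right)
  qed
  \<comment> \<open>Convexity: on the interval from \<alpha> to \<beta>, the function
    \<open>\<bar>y - m\<bar>\<close> lies below the chord through its end values. Averaging the
    chord replaces \<open>y\<close> by \<open>m\<close>, and the inequality of arithmetic and
    geometric means bounds the result.\<close>
  have "(\<beta> - \<alpha>) * (\<Sum>x\<in>X. p x * \<bar>h x - m\<bar>)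
      \<le> (\<Sum>x\<in>X. p x * ((\<beta> - h x) * (m - \<alpha>) + (h x - \<alpha>) * (\<beta> - m)))"
    unfolding sum_distrib_left
  proof (rule sum_mono)
    fix x assume x: "x \<in> X"
    have "(\<beta> - \<alpha>) * \<bar>h x - m\<bar> \<le> (\<beta> - h x) * (m - \<alpha>) + (h x - \<alpha>) * (\<beta> - m)"
    proof (cases "m \<le> h x")
      case True
      have "0 \<le> (\<beta> - h x) * (m - \<alpha>)" using hb[OF x] m1 by simp
      then show ?thesis using True by (simp add: algebra_simps)
    next
      case False
      have "0 \<le> (h x - \<alpha>) * (\<beta> - m)" using hb[OF x] m1 by simp
      then show ?thesis using False by (simp add: algebra_simps)
    qed
    from mult_left_mono[OF this assms(2)[OF x]]
    show "(\<beta> - \<alpha>) * (p x * \<bar>h x - m\<bar>) \<le> p x * ((\<beta> - h x) * (m - \<alpha>) + (h x - \<alpha>) * (\<beta> - m))"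
      by (simp add: algebra_simps)
  qed
  also have "\<dots> = 2 * (\<beta> - m) * (m - \<alpha>)"
  proof -
    have "(\<Sum>x\<in>X. p x * ((\<beta> - h x) * (m - \<alpha>) + (h x - \<alpha>) * (\<beta> - m)))
       = (\<Sum>x\<in>X. p x * (\<beta> * (m - \<alpha>) - \<alpha> * (\<beta> - m)) + p x * h x * ((\<beta> - m) - (m - \<alpha>)))"
      by (rule sum.cong) (auto simp: algebra_simps)
    also have "\<dots> = (\<beta> * (m - \<alpha>) - \<alpha> * (\<beta> - m)) + m * ((\<beta> - m) - (m - \<alpha>))"
      using assms(3) by (simp add: sum.distrib m_def flip: sum_distrib_right)
    finally show ?thesis by (simp add: algebra_simps)
  qed
  also have "\<dots> \<le> (\<beta> - \<alpha>) * ((\<beta> - \<alpha>) / 2)"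
    using zero_le_square[of "(\<beta> - m) - (m - \<alpha>)"] by (simp add: algebra_simps)
  finally have *: "(\<beta> - \<alpha>) * (\<Sum>x\<in>X. p x * \<bar>h x - m\<bar>) \<le> (\<beta> - \<alpha>) * ((\<beta> - \<alpha>) / 2)" .
  have E: "(\<Sum>x\<in>X. p x * \<bar>h x - m\<bar>) \<le> b / 2"
  proof (cases "\<alpha> < \<beta>")
    case True
    then have "(\<Sum>x\<in>X. p x * \<bar>h x - m\<bar>) \<le> (\<beta> - \<alpha>) / 2"
      using * by (subst (asm) mult_le_cancel_left_pos) auto
    also have "\<dots> \<le> b / 2" using ba by simp
    finally show ?thesis .
  next
    case False
    then have "h x = m" if "x \<in> X" for x using hb[OF that] m1 by linarith
    then have "(\<Sum>x\<in>X. p x * \<bar>h x - m\<bar>) = 0" by (intro sum.neutral) auto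
    then show ?thesis using ba False m1 by linarith
  qed
  have "(\<Sum>x\<in>X. p x * (g x * h x)) - (\<Sum>x\<in>X. p x * g x) * m
      = (\<Sum>x\<in>X. p x * ((g x - c) * (h x - m)))"
  proof -
    have "(\<Sum>x\<in>X. p x * ((g x - c) * (h x - m)))
      = (\<Sum>x\<in>X. p x * (g x * h x) - p x * g x * m - c * (p x * h x) + p x * (c * m))"
      by (rule sum.cong) (auto simp: algebra_simps)
    also have "\<dots> = (\<Sum>x\<in>X. p x * (g x * h x)) - (\<Sum>x\<in>X. p x * g x) * m - c * m + c * m"
      using assms(3)
      by (simp add: sum.distrib sum_subtractf m_def flip: sum_distrib_right sum_distrib_left)
    finally show ?thesis by simp
  qed
  also have "\<bar>\<dots>\<bar> \<le> (\<Sum>x\<in>X. d / 2 * (p x * \<bar>h x - m\<bar>))"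
  proof (rule order_trans[OF sum_abs], rule sum_mono)
    fix x assume x: "x \<in> X"
    have "\<bar>g x - c\<bar> * (p x * \<bar>h x - m\<bar>) \<le> d / 2 * (p x * \<bar>h x - m\<bar>)"
      using gc[OF x] assms(2)[OF x] by (intro mult_right_mono) auto
    then show "\<bar>p x * ((g x - c) * (h x - m))\<bar> \<le> d / 2 * (p x * \<bar>h x - m\<bar>)"
      using assms(2)[OF x] by (simp add: abs_mult mult.left_commute)
  qed
  also have "\<dots> \<le> d / 2 * (b / 2)"
    unfolding sum_distrib_left[symmetric] using E d0 by (intro mult_left_mono) auto
  finally show ?thesis by (simp add: m_def algebra_simps)
qed

text \<open>Interpolating linearly between the two energies, the derivative of the mean of
  \<open>g\<close> is minus a covariance.\<close>

lemma boltzmann_mean_diff_le: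
  fixes g u w :: "'a \<Rightarrow> real"
  assumes X: "finite X" "X \<noteq> {}"
    and g: "\<And>x y. x \<in> X \<Longrightarrow> y \<in> X \<Longrightarrow> \<bar>g x - g y\<bar> \<le> d"
    and h: "\<And>x y. x \<in> X \<Longrightarrow> y \<in> X \<Longrightarrow> \<bar>(u x - w x) - (u y - w y)\<bar> \<le> b"
  shows "\<bar>(\<Sum>x\<in>X. g x * exp (- u x)) / (\<Sum>x\<in>X. exp (- u x))
        - (\<Sum>x\<in>X. g x * exp (- w x)) / (\<Sum>x\<in>X. exp (- w x))\<bar> \<le> b * d / 4"
proof -
  \<comment> \<open>Unnormalised weight for the energy \<open>w + t * (u - w)\<close>: time 0 gives
    \<open>w\<close> and time 1 gives \<open>u\<close>, so the mean value theorem on the unit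
    interval compares the two averages.\<close>
  define e where "e x t = exp (- w x - t * (u x - w x))" for x t
  define Z where "Z t = (\<Sum>x\<in>X. e x t)" for t
  define N where "N t = (\<Sum>x\<in>X. g x * e x t)" for t
  define Z' where "Z' t = (\<Sum>x\<in>X. - (u x - w x) * e x t)" for t
  define N' where "N' t = (\<Sum>x\<in>X. g x * (- (u x - w x) * e x t))" for t
  have Zpos: "Z t > 0" for t unfolding Z_def e_def using X by (intro sum_pos) auto
  have e': "((\<lambda>t. e x t) has_real_derivative - (u x - w x) * e x t) (at t)" for x t
    unfolding e_def by (auto intro!: derivative_eq_intros simp: algebra_simps)
  have dZ: "(Z has_real_derivative Z' t) (at t)" for t
    unfolding Z_def Z'_def by (intro DERIV_sum e')
  have dN: "(N has_real_derivative N' t) (at t)" for t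
    unfolding N_def N'_def by (intro DERIV_sum DERIV_cmult e')
  have dF: "((\<lambda>t. N t / Z t) has_real_derivative (N' t * Z t - N t * Z' t) / (Z t * Z t)) (at t)" for t
    by (intro DERIV_divide dN dZ) (use Zpos[of t] in auto)
  have bound: "\<bar>(N' t * Z t - N t * Z' t) / (Z t * Z t)\<bar> \<le> b * d / 4" for t
  proof -
    define p where "p x = e x t / Z t" for x
    have "\<bar>(\<Sum>x\<in>X. p x * (g x * (u x - w x))) - (\<Sum>x\<in>X. p x * g x) * (\<Sum>x\<in>X. p x * (u x - w x))\<bar>
       \<le> b * d / 4"
    proof (rule covariance_le_oscillations)
      show "sum p X = 1" unfolding p_def using Zpos[of t]
        by (simp add: Z_def flip: sum_divide_distrib)
      show "0 \<le> p x" if "x \<in> X" for x using Zpos[of t] by (simp add: p_def e_def)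
    qed (use assms in auto)
    moreover have "(\<Sum>x\<in>X. p x * (g x * (u x - w x))) = - N' t / Z t"
      unfolding p_def N'_def sum_negf[symmetric] sum_divide_distrib
      using Zpos[of t] by (intro sum.cong) (auto simp: field_simps)
    moreover have "(\<Sum>x\<in>X. p x * g x) = N t / Z t"
      unfolding p_def N_def sum_divide_distrib by (rule sum.cong) (auto simp: algebra_simps)
    moreover have "(\<Sum>x\<in>X. p x * (u x - w x)) = - Z' t / Z t"
      unfolding p_def Z'_def sum_negf[symmetric] sum_divide_distrib
      using Zpos[of t] by (intro sum.cong) (auto simp: field_simps)
    moreover have "- N' t / Z t - N t / Z t * (- Z' t / Z t) = - ((N' t * Z t - N t * Z' t) / (Z t * Z t))"
      using Zpos[of t] by (simp add: field_simps)
    ultimately show ?thesis by simp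
  qed
  obtain z where "N 1 / Z 1 - N 0 / Z 0 = (1 - 0) * ((N' z * Z z - N z * Z' z) / (Z z * Z z))"
    using MVT2[of 0 1 "\<lambda>t. N t / Z t", OF zero_less_one dF] by blast
  with bound[of z] have "\<bar>N 1 / Z 1 - N 0 / Z 0\<bar> \<le> b * d / 4" by simp
  then show ?thesis by (simp add: N_def Z_def e_def)
qed

section \<open>Specifications\<close>

text \<open>Extends \<open>gibbs_kernel\<close> from events to arbitrary real functions. As a finite
  weighted average it is linear and monotone with no measurability condition on
  \<open>f\<close>.\<close>

definition spec :: "('e::finite) interaction \<Rightarrow> int set \<Rightarrow> ('e config \<Rightarrow> real) \<Rightarrow> 'e config \<Rightarrow> real" where
  "spec \<Phi> \<Lambda> f \<eta> =
     (\<Sum>\<omega>\<in>agree_out \<Lambda> \<eta>. f \<omega> * exp (- hamiltonian \<Phi> \<Lambda> \<omega>))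
     / (\<Sum>\<omega>\<in>agree_out \<Lambda> \<eta>. exp (- hamiltonian \<Phi> \<Lambda> \<omega>))"

lemma gibbs_kernel_eq_spec: "gibbs_kernel \<Phi> \<Lambda> A = spec \<Phi> \<Lambda> (indicator A)"
  by (rule ext) (simp add: gibbs_kernel_def spec_def)

text \<open>Extensional functions on \<Lambda> index the fibre
  \<open>agree_out \<Lambda> \<eta>\<close> by a set that does not depend on \<eta>. Averages with
  different boundary conditions can then be compared term by term, and their dependence on \<eta> is
  visibly measurable.\<close>

abbreviation patterns :: "int set \<Rightarrow> ('e::finite) config set" where
  "patterns \<Lambda> \<equiv> PiE \<Lambda> (\<lambda>_. UNIV)"

lemma finite_patterns: "finite \<Lambda> \<Longrightarrow> finite (patterns \<Lambda>)"
  by (auto intro: finite_PiE)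

lemma patterns_nonempty: "patterns \<Lambda> \<noteq> {}"
  by (auto simp: PiE_eq_empty_iff)

lemma agree_out_eq_image: "agree_out \<Lambda> \<eta> = (\<lambda>x. override_on \<eta> x \<Lambda>) ` patterns \<Lambda>"
proof (intro equalityI subsetI)
  fix \<omega> assume "\<omega> \<in> agree_out \<Lambda> \<eta>"
  then have "\<omega> = override_on \<eta> (restrict \<omega> \<Lambda>) \<Lambda>"
    by (auto simp: agree_out_def override_on_def)
  then show "\<omega> \<in> (\<lambda>x. override_on \<eta> x \<Lambda>) ` patterns \<Lambda>"
    by (rule image_eqI[of _ _ "restrict \<omega> \<Lambda>"]) simp
qed (auto simp: agree_out_def)

lemma inj_on_override: "inj_on (\<lambda>x. override_on \<eta> x \<Lambda>) (patterns \<Lambda>)"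
proof (rule inj_onI)
  fix x y :: "int \<Rightarrow> 'a"
  assume xy: "x \<in> patterns \<Lambda>" "y \<in> patterns \<Lambda>" "override_on \<eta> x \<Lambda> = override_on \<eta> y \<Lambda>"
  show "x = y"
  proof (rule PiE_ext[OF xy(1,2)])
    fix i assume "i \<in> \<Lambda>"
    then show "x i = y i" using fun_cong[OF xy(3), of i] by simp
  qed
qed

lemma finite_agree_out: "finite \<Lambda> \<Longrightarrow> finite (agree_out \<Lambda> (\<eta> :: int \<Rightarrow> 'e::finite))"
  by (simp add: agree_out_eq_image finite_patterns)

lemma self_in_agree_out: "\<eta> \<in> agree_out \<Lambda> \<eta>"
  by (simp add: agree_out_def)

lemma agree_out_cong: "\<omega> \<in> agree_out \<Lambda> \<eta> \<Longrightarrow> agree_out \<Lambda> \<omega> = agree_out \<Lambda> \<eta>"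
  by (auto simp: agree_out_def)

lemma agree_out_sym: "\<omega> \<in> agree_out \<Lambda> \<eta> \<longleftrightarrow> \<eta> \<in> agree_out \<Lambda> \<omega>"
  by (auto simp: agree_out_def)

lemma agree_out_mono: "\<Lambda> \<subseteq> \<Lambda>' \<Longrightarrow> agree_out \<Lambda> \<eta> \<subseteq> agree_out \<Lambda>' \<eta>"
  by (auto simp: agree_out_def)

lemma sum_agree_out:
  "(\<Sum>\<omega>\<in>agree_out \<Lambda> \<eta>. g \<omega>) = (\<Sum>x\<in>patterns \<Lambda>. g (override_on \<eta> x \<Lambda>))"
  unfolding agree_out_eq_image by (subst sum.reindex[OF inj_on_override]) simp

lemma partition_function_pos:
  assumes "finite \<Lambda>"
  shows "0 < (\<Sum>\<omega>\<in>agree_out \<Lambda> (\<eta> :: int \<Rightarrow> 'e::finite). exp (- (H \<omega> :: real)))"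
  using finite_agree_out[OF assms] self_in_agree_out by (intro sum_pos) auto

lemma spec_const: "finite \<Lambda> \<Longrightarrow> spec \<Phi> \<Lambda> (\<lambda>_. c) \<eta> = c"
  using partition_function_pos[where \<Lambda> = \<Lambda> and \<eta> = \<eta> and H = "hamiltonian \<Phi> \<Lambda>"]
  by (simp add: spec_def flip: sum_distrib_left)

lemma spec_add: "spec \<Phi> \<Lambda> (\<lambda>\<omega>. f \<omega> + g \<omega>) \<eta> = spec \<Phi> \<Lambda> f \<eta> + spec \<Phi> \<Lambda> g \<eta>"
  by (simp add: spec_def algebra_simps sum.distrib add_divide_distrib)

lemma spec_diff: "spec \<Phi> \<Lambda> (\<lambda>\<omega>. f \<omega> - g \<omega>) \<eta> = spec \<Phi> \<Lambda> f \<eta> - spec \<Phi> \<Lambda> g \<eta>"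
  by (simp add: spec_def algebra_simps sum_subtractf diff_divide_distrib)

lemma spec_pull_out:
  assumes "\<And>\<omega>. \<omega> \<in> agree_out \<Lambda> \<eta> \<Longrightarrow> h \<omega> = c"
  shows "spec \<Phi> \<Lambda> (\<lambda>\<omega>. h \<omega> * f \<omega>) \<eta> = c * spec \<Phi> \<Lambda> f \<eta>"
  by (simp add: spec_def assms sum_distrib_left mult.assoc)

lemma spec_cmult: "spec \<Phi> \<Lambda> (\<lambda>\<omega>. c * f \<omega>) \<eta> = c * spec \<Phi> \<Lambda> f \<eta>"
  by (rule spec_pull_out) simp

lemma spec_cong: "(\<And>\<omega>. \<omega> \<in> agree_out \<Lambda> \<eta> \<Longrightarrow> f \<omega> = g \<omega>) \<Longrightarrow> spec \<Phi> \<Lambda> f \<eta> = spec \<Phi> \<Lambda> g \<eta>"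
  by (simp add: spec_def)

lemma spec_sum: "spec \<Phi> \<Lambda> (\<lambda>\<omega>. \<Sum>x\<in>X. f x \<omega>) \<eta> = (\<Sum>x\<in>X. spec \<Phi> \<Lambda> (f x) \<eta>)"
  unfolding spec_def sum_distrib_right sum_divide_distrib by (rule sum.swap)

lemma spec_mono:
  assumes "\<And>\<omega>. \<omega> \<in> agree_out \<Lambda> \<eta> \<Longrightarrow> f \<omega> \<le> g \<omega>"
  shows "spec \<Phi> \<Lambda> f \<eta> \<le> spec \<Phi> \<Lambda> g \<eta>"
  unfolding spec_def using assms
  by (intro divide_right_mono sum_mono mult_right_mono sum_nonneg) auto

lemma spec_agree: "\<omega> \<in> agree_out \<Lambda> \<eta> \<Longrightarrow> spec \<Phi> \<Lambda> f \<omega> = spec \<Phi> \<Lambda> f \<eta>"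
  by (simp add: spec_def agree_out_cong)

lemma spec_between:
  assumes "finite \<Lambda>" "\<And>\<omega>. \<omega> \<in> agree_out \<Lambda> \<eta> \<Longrightarrow> a \<le> f \<omega>" "\<And>\<omega>. \<omega> \<in> agree_out \<Lambda> \<eta> \<Longrightarrow> f \<omega> \<le> b"
  shows "a \<le> spec \<Phi> \<Lambda> f \<eta>" "spec \<Phi> \<Lambda> f \<eta> \<le> b"
proof -
  show "a \<le> spec \<Phi> \<Lambda> f \<eta>"
    using spec_mono[of \<Lambda> \<eta> "\<lambda>_. a" f \<Phi>] assms by (simp add: spec_const)
  show "spec \<Phi> \<Lambda> f \<eta> \<le> b"
    using spec_mono[of \<Lambda> \<eta> f "\<lambda>_. b" \<Phi>] assms by (simp add: spec_const)
qed

lemma spec_abs_diff_le: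
  assumes "finite \<Lambda>" "\<And>\<omega>. \<omega> \<in> agree_out \<Lambda> \<eta> \<Longrightarrow> \<bar>f \<omega> - c\<bar> \<le> b"
  shows "\<bar>spec \<Phi> \<Lambda> f \<eta> - c\<bar> \<le> b"
proof -
  have "c - b \<le> f \<omega> \<and> f \<omega> \<le> c + b" if "\<omega> \<in> agree_out \<Lambda> \<eta>" for \<omega>
    using assms(2)[OF that] by linarith
  with spec_between[of \<Lambda> \<eta> "c - b" f "c + b" \<Phi>] assms(1) show ?thesis by force
qed

lemma spec_abs_le:
  "finite \<Lambda> \<Longrightarrow> (\<And>\<omega>. \<bar>f \<omega>\<bar> \<le> b) \<Longrightarrow> \<bar>spec \<Phi> \<Lambda> f \<eta>\<bar> \<le> b"
  using spec_abs_diff_le[of \<Lambda> \<eta> f 0 b \<Phi>] by simp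

text \<open>The boundary enters twice. Replacing \<open>f\<close> by the function that always reads
  the boundary \<eta> costs \<open>a\<close>; afterwards the same function of the inner pattern is
  averaged with two Boltzmann weights, which costs \<open>b * d / 4\<close>.\<close>

lemma spec_compare:
  assumes \<Lambda>: "finite \<Lambda>"
    and a: "\<And>x. x \<in> patterns \<Lambda> \<Longrightarrow> \<bar>f (override_on \<xi> x \<Lambda>) - f (override_on \<eta> x \<Lambda>)\<bar> \<le> a"
    and d: "\<And>x y. x \<in> patterns \<Lambda> \<Longrightarrow> y \<in> patterns \<Lambda> \<Longrightarrow>
        \<bar>f (override_on \<eta> x \<Lambda>) - f (override_on \<eta> y \<Lambda>)\<bar> \<le> d"
    and b: "\<And>x y. x \<in> patterns \<Lambda> \<Longrightarrow> y \<in> patterns \<Lambda> \<Longrightarrow>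
        \<bar>(hamiltonian \<Phi> \<Lambda> (override_on \<xi> x \<Lambda>) - hamiltonian \<Phi> \<Lambda> (override_on \<eta> x \<Lambda>))
         - (hamiltonian \<Phi> \<Lambda> (override_on \<xi> y \<Lambda>) - hamiltonian \<Phi> \<Lambda> (override_on \<eta> y \<Lambda>))\<bar> \<le> b"
  shows "\<bar>spec \<Phi> \<Lambda> f \<xi> - spec \<Phi> \<Lambda> f \<eta>\<bar> \<le> a + b * d / 4"
proof -
  define g where "g x = f (override_on \<eta> x \<Lambda>)" for x
  define u where "u x = hamiltonian \<Phi> \<Lambda> (override_on \<xi> x \<Lambda>)" for x
  define w where "w x = hamiltonian \<Phi> \<Lambda> (override_on \<eta> x \<Lambda>)" for x
  let ?g = "\<lambda>\<omega>. f (override_on \<eta> \<omega> \<Lambda>)"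
  have ov: "override_on \<eta> (override_on \<xi> x \<Lambda>) \<Lambda> = override_on \<eta> x \<Lambda>" for x :: "int \<Rightarrow> 'a"
    by (auto simp: override_on_def)
  have "\<bar>spec \<Phi> \<Lambda> (\<lambda>\<omega>. f \<omega> - ?g \<omega>) \<xi> - 0\<bar> \<le> a"
    by (rule spec_abs_diff_le[OF \<Lambda>]) (auto simp: agree_out_eq_image ov a)
  then have 1: "\<bar>spec \<Phi> \<Lambda> f \<xi> - spec \<Phi> \<Lambda> ?g \<xi>\<bar> \<le> a" by (simp add: spec_diff)
  have "spec \<Phi> \<Lambda> ?g \<xi> = (\<Sum>x\<in>patterns \<Lambda>. g x * exp (- u x)) / (\<Sum>x\<in>patterns \<Lambda>. exp (- u x))"
    unfolding spec_def sum_agree_out ov g_def u_def ..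
  moreover have "spec \<Phi> \<Lambda> f \<eta> = (\<Sum>x\<in>patterns \<Lambda>. g x * exp (- w x)) / (\<Sum>x\<in>patterns \<Lambda>. exp (- w x))"
    unfolding spec_def sum_agree_out g_def w_def ..
  moreover have "\<bar>(\<Sum>x\<in>patterns \<Lambda>. g x * exp (- u x)) / (\<Sum>x\<in>patterns \<Lambda>. exp (- u x))
     - (\<Sum>x\<in>patterns \<Lambda>. g x * exp (- w x)) / (\<Sum>x\<in>patterns \<Lambda>. exp (- w x))\<bar> \<le> b * d / 4"
    by (rule boltzmann_mean_diff_le[OF finite_patterns[OF \<Lambda>] patterns_nonempty])
      (use b d in \<open>auto simp: g_def u_def w_def\<close>)
  ultimately show ?thesis using 1 by linarith
qed

section \<open>From sums of extended nonnegative reals to real summability\<close>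

lemma finite_sum_le_infsum_ennreal:
  fixes f :: "'a \<Rightarrow> ennreal"
  assumes "finite F" "F \<subseteq> A"
  shows "sum f F \<le> infsum f A"
  using assms by (auto simp: nonneg_infsum_complete intro!: SUP_upper)

lemma summable_on_if_ennreal_infsum_le:
  fixes f :: "'a \<Rightarrow> real"
  assumes "\<And>x. x \<in> A \<Longrightarrow> 0 \<le> f x" "infsum (\<lambda>x. ennreal (f x)) A \<le> ennreal c" "0 \<le> c"
  shows "f summable_on A" "infsum f A \<le> c"
proof -
  have *: "sum f F \<le> c" if "finite F" "F \<subseteq> A" for F
  proof -
    have "ennreal (sum f F) = (\<Sum>x\<in>F. ennreal (f x))"
      using assms(1) that by (subst sum_ennreal) auto
    also have "\<dots> \<le> infsum (\<lambda>x. ennreal (f x)) A"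
      using that by (rule finite_sum_le_infsum_ennreal)
    also have "\<dots> \<le> ennreal c" by fact
    finally show ?thesis using assms(3) by (simp add: ennreal_le_iff)
  qed
  show s: "f summable_on A"
    by (rule nonneg_bdd_above_summable_on) (use assms * in \<open>auto intro!: bdd_aboveI2[of _ _ c]\<close>)
  show "infsum f A \<le> c"
    by (rule infsum_le_finite_sums[OF s *])
qed

lemma summable_on_if_abs_le:
  fixes f g :: "'a \<Rightarrow> real"
  assumes "g summable_on A" "\<And>x. x \<in> A \<Longrightarrow> \<bar>f x\<bar> \<le> g x"
  shows "f summable_on A"
proof (rule abs_summable_summable)
  show "(\<lambda>x. norm (f x)) summable_on A"
    by (rule Infinite_Sum.abs_summable_on_comparison_test'[OF assms(1)]) (use assms(2) in auto)
qed

text \<open>Continuity for the product topology.\<close>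

definition quasilocal :: "('e config \<Rightarrow> real) \<Rightarrow> bool" where
  "quasilocal f \<longleftrightarrow> (\<forall>\<epsilon>>0. \<exists>J. finite J \<and> (\<forall>\<xi> \<eta>. (\<forall>i\<in>J. \<xi> i = \<eta> i) \<longrightarrow> \<bar>f \<xi> - f \<eta>\<bar> \<le> \<epsilon>))"

definition touching :: "int set \<Rightarrow> int set set" where
  "touching \<Lambda> = {V. finite V \<and> V \<inter> \<Lambda> \<noteq> {}}"

locale uac_interaction =
  fixes \<Phi> :: "('e::finite) interaction"
  assumes inter: "interaction \<Phi>" and uac: "UAC \<Phi>"
begin

lemma potential_cong: "finite V \<Longrightarrow> (\<And>i. i \<in> V \<Longrightarrow> \<xi> i = \<eta> i) \<Longrightarrow> \<Phi> V \<xi> = \<Phi> V \<eta>"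
  using inter unfolding interaction_def by blast

lemma finite_range_potential: "finite V \<Longrightarrow> finite (range (\<Phi> V))"
proof (rule finite_subset)
  assume V: "finite V"
  show "range (\<Phi> V) \<subseteq> \<Phi> V ` patterns V"
  proof clarify
    fix \<xi>
    have "\<Phi> V \<xi> = \<Phi> V (restrict \<xi> V)" by (rule potential_cong[OF V]) simp
    then show "\<Phi> V \<xi> \<in> \<Phi> V ` patterns V" by (rule image_eqI[of _ _ "restrict \<xi> V"]) simp
  qed
qed (simp add: finite_patterns)

lemma abs_potential_le: "finite V \<Longrightarrow> \<bar>\<Phi> V \<xi>\<bar> \<le> sup_norm (\<Phi> V)"
  unfolding sup_norm_def
proof (rule cSUP_upper)
  assume "finite V"
  then have "finite (abs ` range (\<Phi> V))" using finite_range_potential by blast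
  then show "bdd_above (range (\<lambda>\<xi>. \<bar>\<Phi> V \<xi>\<bar>))" by (simp add: image_image)
qed simp

lemma sup_norm_nonneg: "finite V \<Longrightarrow> 0 \<le> sup_norm (\<Phi> V)"
  using abs_potential_le[of V undefined] by simp

lemma potential_diff_le_osc: "finite V \<Longrightarrow> \<bar>\<Phi> V \<xi> - \<Phi> V \<eta>\<bar> \<le> osc (\<Phi> V)"
proof -
  assume "finite V"
  then have "finite ((\<lambda>(a, b). \<bar>a - b\<bar>) ` (range (\<Phi> V) \<times> range (\<Phi> V)))"
    using finite_range_potential by blast
  then have "bdd_above (range (\<lambda>p. \<bar>\<Phi> V (fst p) - \<Phi> V (snd p)\<bar>))"
    by (rule bdd_above_mono[OF bdd_above_finite]) auto
  from cSUP_upper[OF _ this, of "(\<xi>, \<eta>)"] show ?thesis unfolding osc_def by simp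
qed

lemma osc_nonneg: "finite V \<Longrightarrow> 0 \<le> osc (\<Phi> V)"
  using potential_diff_le_osc[of V undefined undefined] by simp

lemma osc_le_sup_norm: "finite V \<Longrightarrow> osc (\<Phi> V) \<le> 2 * sup_norm (\<Phi> V)"
  unfolding osc_def
proof (rule cSUP_least)
  fix p :: "'e config \<times> 'e config" assume "finite V"
  from abs_potential_le[OF this, of "fst p"] abs_potential_le[OF this, of "snd p"]
  show "\<bar>\<Phi> V (fst p) - \<Phi> V (snd p)\<bar> \<le> 2 * sup_norm (\<Phi> V)" by linarith
qed simp

lemma summable_sup_norm:
  assumes "finite \<Lambda>" shows "(\<lambda>V. sup_norm (\<Phi> V)) summable_on touching \<Lambda>"
  using assms
proof induction
  case empty
  show ?case by (simp add: touching_def)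
next
  case (insert i \<Lambda>)
  let ?s = "SUP i::int. infsum (\<lambda>V. ennreal (sup_norm (\<Phi> V))) {V. finite V \<and> i \<in> V}"
  have "infsum (\<lambda>V. ennreal (sup_norm (\<Phi> V))) {V. finite V \<and> i \<in> V} \<le> ?s"
    by (rule SUP_upper) simp
  also have "\<dots> = ennreal (enn2real ?s)"
    using uac unfolding UAC_def by (subst ennreal_enn2real) auto
  finally have "(\<lambda>V. sup_norm (\<Phi> V)) summable_on {V. finite V \<and> i \<in> V}"
    by (intro summable_on_if_ennreal_infsum_le(1)) (auto intro: sup_norm_nonneg)
  moreover have "touching (insert i \<Lambda>) = {V. finite V \<and> i \<in> V} \<union> touching \<Lambda>"
    by (auto simp: touching_def)
  ultimately show ?case using insert.IH by (simp add: summable_on_union)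
qed

lemma summable_potential:
  assumes "finite \<Lambda>" shows "(\<lambda>V. \<Phi> V \<omega>) summable_on touching \<Lambda>"
proof (rule summable_on_if_abs_le[OF summable_sup_norm[OF assms]])
  show "\<bar>\<Phi> V \<omega>\<bar> \<le> sup_norm (\<Phi> V)" if "V \<in> touching \<Lambda>" for V
    using that abs_potential_le by (simp add: touching_def)
qed

lemma hamiltonian_eq: "hamiltonian \<Phi> \<Lambda> \<omega> = infsum (\<lambda>V. \<Phi> V \<omega>) (touching \<Lambda>)"
  by (simp add: hamiltonian_def touching_def)

lemma hamiltonian_diff:
  assumes "finite \<Lambda>"
  shows "hamiltonian \<Phi> \<Lambda> \<xi> - hamiltonian \<Phi> \<Lambda> \<eta> = infsum (\<lambda>V. \<Phi> V \<xi> - \<Phi> V \<eta>) (touching \<Lambda>)"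
  unfolding hamiltonian_eq using infsum_add[OF summable_potential[OF assms, of \<xi>]
    summable_on_uminus[THEN iffD2, OF summable_potential[OF assms, of \<eta>]]]
  by (simp add: infsum_uminus)

text \<open>A set that touches \<Lambda>' but not \<Lambda> sees no difference between
  configurations agreeing off \<Lambda>. Hence the weights of the two volumes are proportional on
  each fibre of the smaller one.\<close>

lemma hamiltonian_diff_mono:
  assumes "\<Lambda> \<subseteq> \<Lambda>'" "finite \<Lambda>'" "\<xi> \<in> agree_out \<Lambda> \<eta>"
  shows "hamiltonian \<Phi> \<Lambda>' \<xi> - hamiltonian \<Phi> \<Lambda>' \<eta> = hamiltonian \<Phi> \<Lambda> \<xi> - hamiltonian \<Phi> \<Lambda> \<eta>"
proof -
  have "finite \<Lambda>" using assms by (blast intro: finite_subset)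
  show ?thesis unfolding hamiltonian_diff[OF assms(2)] hamiltonian_diff[OF \<open>finite \<Lambda>\<close>]
  proof (rule infsum_cong_neutral)
    fix V assume "V \<in> touching \<Lambda>' - touching \<Lambda>"
    then have "\<Phi> V \<xi> = \<Phi> V \<eta>"
      using assms(3) by (intro potential_cong) (auto simp: touching_def agree_out_def)
    then show "\<Phi> V \<xi> - \<Phi> V \<eta> = 0" by simp
  next
    fix V assume "V \<in> touching \<Lambda> - touching \<Lambda>'"
    then show "\<Phi> V \<xi> - \<Phi> V \<eta> = 0" using assms(1) by (auto simp: touching_def)
  qed simp
qed

text \<open>Averaging over \<Lambda> inside \<Lambda>' is reversible with respect to the weights of
  \<Lambda>'. After expansion both averages form a double sum over pairs that agree off \<Lambda>;
  exchanging the two summations lets the inner normalisation cancel.\<close>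

lemma spec_consistent:
  assumes "\<Lambda> \<subseteq> \<Lambda>'" "finite \<Lambda>'"
  shows "spec \<Phi> \<Lambda>' (spec \<Phi> \<Lambda> f) \<eta> = spec \<Phi> \<Lambda>' f \<eta>"
proof -
  have fin: "finite \<Lambda>" using assms by (blast intro: finite_subset)
  let ?S = "agree_out \<Lambda>' \<eta>"
  let ?w = "\<lambda>\<omega>. exp (- hamiltonian \<Phi> \<Lambda> \<omega>)"
  let ?W = "\<lambda>\<omega>. exp (- hamiltonian \<Phi> \<Lambda>' \<omega>)"
  define Z where "Z \<omega> = (\<Sum>\<zeta>\<in>agree_out \<Lambda> \<omega>. ?w \<zeta>)" for \<omega>
  have Zpos: "Z \<omega> > 0" for \<omega> unfolding Z_def using fin by (rule partition_function_pos)
  have sub: "agree_out \<Lambda> \<omega> \<subseteq> ?S" if "\<omega> \<in> ?S" for \<omega>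
    using agree_out_mono[OF assms(1), of \<omega>] agree_out_cong[OF that] by simp
  have finS: "finite ?S" using assms(2) by (rule finite_agree_out)
  \<comment> \<open>Detailed balance, the multiplicative form of the proportionality of the
    weights.\<close>
  have swap: "?W \<omega> * ?w \<zeta> = ?W \<zeta> * ?w \<omega>" if "\<zeta> \<in> agree_out \<Lambda> \<omega>" for \<zeta> \<omega>
    unfolding exp_add[symmetric] using hamiltonian_diff_mono[OF assms that] by simp
  have "(\<Sum>\<omega>\<in>?S. spec \<Phi> \<Lambda> f \<omega> * ?W \<omega>)
      = (\<Sum>\<omega>\<in>?S. \<Sum>\<zeta>\<in>agree_out \<Lambda> \<omega>. f \<zeta> * ?W \<zeta> * ?w \<omega> / Z \<zeta>)"
  proof (rule sum.cong[OF refl])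
    fix \<omega> assume \<omega>: "\<omega> \<in> ?S"
    have "spec \<Phi> \<Lambda> f \<omega> * ?W \<omega> = (\<Sum>\<zeta>\<in>agree_out \<Lambda> \<omega>. f \<zeta> * (?W \<omega> * ?w \<zeta>) / Z \<omega>)"
      by (simp add: spec_def Z_def sum_distrib_left sum_divide_distrib sum_distrib_right algebra_simps)
    also have "\<dots> = (\<Sum>\<zeta>\<in>agree_out \<Lambda> \<omega>. f \<zeta> * ?W \<zeta> * ?w \<omega> / Z \<zeta>)"
      by (intro sum.cong) (auto simp: swap Z_def agree_out_cong)
    finally show "spec \<Phi> \<Lambda> f \<omega> * ?W \<omega> = \<dots>" .
  qed
  also have "\<dots> = (\<Sum>\<omega>\<in>?S. \<Sum>\<zeta>\<in>{\<zeta>\<in>?S. \<zeta> \<in> agree_out \<Lambda> \<omega>}. f \<zeta> * ?W \<zeta> * ?w \<omega> / Z \<zeta>)"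
    using sub by (intro sum.cong) auto
  also have "\<dots> = (\<Sum>\<zeta>\<in>?S. \<Sum>\<omega>\<in>{\<omega>\<in>?S. \<zeta> \<in> agree_out \<Lambda> \<omega>}. f \<zeta> * ?W \<zeta> * ?w \<omega> / Z \<zeta>)"
    by (rule sum.swap_restrict[OF finS finS])
  also have "\<dots> = (\<Sum>\<zeta>\<in>?S. \<Sum>\<omega>\<in>agree_out \<Lambda> \<zeta>. f \<zeta> * ?W \<zeta> * ?w \<omega> / Z \<zeta>)"
  proof (rule sum.cong[OF refl], rule sum.cong)
    fix \<zeta> assume "\<zeta> \<in> ?S"
    then show "{\<omega>\<in>?S. \<zeta> \<in> agree_out \<Lambda> \<omega>} = agree_out \<Lambda> \<zeta>"
      using sub[of \<zeta>] agree_out_sym[of \<zeta> \<Lambda>] by blast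
  qed simp
  also have "\<dots> = (\<Sum>\<zeta>\<in>?S. f \<zeta> * ?W \<zeta>)"
  proof (rule sum.cong[OF refl])
    fix \<zeta>
    have "(\<Sum>\<omega>\<in>agree_out \<Lambda> \<zeta>. f \<zeta> * ?W \<zeta> * ?w \<omega> / Z \<zeta>) = f \<zeta> * ?W \<zeta> * Z \<zeta> / Z \<zeta>"
      unfolding sum_divide_distrib[symmetric] sum_distrib_left[symmetric] Z_def ..
    then show "(\<Sum>\<omega>\<in>agree_out \<Lambda> \<zeta>. f \<zeta> * ?W \<zeta> * ?w \<omega> / Z \<zeta>) = f \<zeta> * ?W \<zeta>"
      using Zpos[of \<zeta>] by simp
  qed
  finally show ?thesis unfolding spec_def[of \<Phi> \<Lambda>'] by simp
qed

text \<open>By \<open>UAC\<close> the norms of all but finitely many of the touching potentials sum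
  to at most \<open>\<epsilon> / 2\<close>. Agreement on the union of the exceptional sets suffices,
  since each remaining potential changes by at most twice its norm.\<close>

lemma quasilocal_hamiltonian:
  assumes "finite \<Lambda>" shows "quasilocal (hamiltonian \<Phi> \<Lambda>)"
  unfolding quasilocal_def
proof (intro allI impI)
  fix \<epsilon> :: real assume "\<epsilon> > 0"
  let ?s = "\<lambda>V. sup_norm (\<Phi> V)"
  from infsum_finite_approximation[OF summable_sup_norm[OF assms], of "\<epsilon> / 2"] \<open>\<epsilon> > 0\<close>
  obtain F where F: "finite F" "F \<subseteq> touching \<Lambda>"
    "dist (sum ?s F) (infsum ?s (touching \<Lambda>)) \<le> \<epsilon> / 2" by auto
  have s: "?s summable_on (touching \<Lambda> - F)"
    by (rule summable_on_subset_banach[OF summable_sup_norm[OF assms]]) auto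
  have "infsum ?s (touching \<Lambda>) = sum ?s F + infsum ?s (touching \<Lambda> - F)"
  proof -
    have "infsum ?s (F \<union> (touching \<Lambda> - F)) = infsum ?s F + infsum ?s (touching \<Lambda> - F)"
      using F s by (intro infsum_Un_disjoint) auto
    moreover have "F \<union> (touching \<Lambda> - F) = touching \<Lambda>" using F by auto
    ultimately show ?thesis using F by simp
  qed
  then have tail: "infsum ?s (touching \<Lambda> - F) \<le> \<epsilon> / 2"
    using F(3) by (simp add: dist_real_def)
  show "\<exists>J. finite J \<and> (\<forall>\<xi> \<eta>. (\<forall>i\<in>J. \<xi> i = \<eta> i) \<longrightarrow>
      \<bar>hamiltonian \<Phi> \<Lambda> \<xi> - hamiltonian \<Phi> \<Lambda> \<eta>\<bar> \<le> \<epsilon>)"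
  proof (intro exI conjI allI impI)
    show "finite (\<Union>F)" using F by (auto simp: touching_def)
    fix \<xi> \<eta> :: "'e config" assume eq: "\<forall>i\<in>\<Union>F. \<xi> i = \<eta> i"
    have "hamiltonian \<Phi> \<Lambda> \<xi> - hamiltonian \<Phi> \<Lambda> \<eta>
       = infsum (\<lambda>V. \<Phi> V \<xi> - \<Phi> V \<eta>) (touching \<Lambda> - F)"
      unfolding hamiltonian_diff[OF assms]
    proof (rule infsum_cong_neutral)
      fix V assume "V \<in> touching \<Lambda> - (touching \<Lambda> - F)"
      then have "\<Phi> V \<xi> = \<Phi> V \<eta>" using eq by (intro potential_cong) (auto simp: touching_def)
      then show "\<Phi> V \<xi> - \<Phi> V \<eta> = 0" by simp
    qed auto
    also have "\<bar>\<dots>\<bar> \<le> infsum (\<lambda>V. 2 * ?s V) (touching \<Lambda> - F)"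
      unfolding real_norm_def[symmetric]
    proof (rule norm_infsum_le[OF has_sum_infsum has_sum_infsum])
      show sum2: "(\<lambda>V. 2 * ?s V) summable_on (touching \<Lambda> - F)"
        using s by (rule summable_on_cmult_right)
      show le: "norm (\<Phi> V \<xi> - \<Phi> V \<eta>) \<le> 2 * ?s V" if "V \<in> touching \<Lambda> - F" for V
        using that abs_potential_le[of V \<xi>] abs_potential_le[of V \<eta>] by (auto simp: touching_def)
      show "(\<lambda>V. \<Phi> V \<xi> - \<Phi> V \<eta>) summable_on (touching \<Lambda> - F)"
        using summable_on_if_abs_le[OF sum2] le by simp
    qed
    also have "\<dots> = 2 * infsum ?s (touching \<Lambda> - F)"
      using s by (intro infsum_cmult_right) auto
    also have "\<dots> \<le> \<epsilon>" using tail by simp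
    finally show "\<bar>hamiltonian \<Phi> \<Lambda> \<xi> - hamiltonian \<Phi> \<Lambda> \<eta>\<bar> \<le> \<epsilon>" .
  qed
qed

lemma quasilocal_spec:
  assumes \<Lambda>: "finite \<Lambda>" and f: "quasilocal f" "\<And>\<omega>. \<bar>f \<omega>\<bar> \<le> B"
  shows "quasilocal (spec \<Phi> \<Lambda> f)"
  unfolding quasilocal_def
proof (intro allI impI)
  fix \<epsilon> :: real assume \<epsilon>: "\<epsilon> > 0"
  have B: "0 \<le> B" using f(2)[of undefined] by simp
  obtain J1 where J1: "finite J1" "\<And>\<xi> \<eta>. (\<forall>i\<in>J1. \<xi> i = \<eta> i) \<Longrightarrow> \<bar>f \<xi> - f \<eta>\<bar> \<le> \<epsilon> / 2"
    using f(1) \<epsilon> unfolding quasilocal_def by (meson half_gt_zero)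
  \<comment> \<open>The energies enter \<open>spec_compare\<close> with \<open>b = 2 * e\<close> and
    \<open>d = 2 * B\<close>, hence through \<open>e * B\<close>, which is to be at most
    \<open>\<epsilon> / 2\<close>. The added 1 keeps the denominator positive when
    \<open>B = 0\<close>.\<close>
  define e where "e = \<epsilon> / (2 * (B + 1))"
  have "e > 0" using \<epsilon> B by (simp add: e_def)
  then obtain J2 where J2: "finite J2" "\<And>\<xi> \<eta>. (\<forall>i\<in>J2. \<xi> i = \<eta> i) \<Longrightarrow>
      \<bar>hamiltonian \<Phi> \<Lambda> \<xi> - hamiltonian \<Phi> \<Lambda> \<eta>\<bar> \<le> e"
    using quasilocal_hamiltonian[OF \<Lambda>] unfolding quasilocal_def by meson
  show "\<exists>J. finite J \<and> (\<forall>\<xi> \<eta>. (\<forall>i\<in>J. \<xi> i = \<eta> i) \<longrightarrow> \<bar>spec \<Phi> \<Lambda> f \<xi> - spec \<Phi> \<Lambda> f \<eta>\<bar> \<le> \<epsilon>)"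
  proof (intro exI conjI allI impI)
    show "finite (J1 \<union> J2)" using J1 J2 by simp
    fix \<xi> \<eta> :: "'e config" assume eq: "\<forall>i\<in>J1 \<union> J2. \<xi> i = \<eta> i"
    have "\<bar>spec \<Phi> \<Lambda> f \<xi> - spec \<Phi> \<Lambda> f \<eta>\<bar> \<le> \<epsilon> / 2 + (2 * e) * (2 * B) / 4"
    proof (rule spec_compare[OF \<Lambda>])
      fix x y :: "'e config"
      show "\<bar>f (override_on \<xi> x \<Lambda>) - f (override_on \<eta> x \<Lambda>)\<bar> \<le> \<epsilon> / 2"
        using eq by (intro J1(2)) (auto simp: override_on_def)
      show "\<bar>f (override_on \<eta> x \<Lambda>) - f (override_on \<eta> y \<Lambda>)\<bar> \<le> 2 * B"
        using f(2)[of "override_on \<eta> x \<Lambda>"] f(2)[of "override_on \<eta> y \<Lambda>"] by linarith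
      have "\<bar>hamiltonian \<Phi> \<Lambda> (override_on \<xi> z \<Lambda>) - hamiltonian \<Phi> \<Lambda> (override_on \<eta> z \<Lambda>)\<bar> \<le> e" for z
        using eq by (intro J2(2)) (auto simp: override_on_def)
      from this[of x] this[of y]
      show "\<bar>hamiltonian \<Phi> \<Lambda> (override_on \<xi> x \<Lambda>) - hamiltonian \<Phi> \<Lambda> (override_on \<eta> x \<Lambda>)
         - (hamiltonian \<Phi> \<Lambda> (override_on \<xi> y \<Lambda>) - hamiltonian \<Phi> \<Lambda> (override_on \<eta> y \<Lambda>))\<bar> \<le> 2 * e"
        by linarith
    qed
    also have "\<dots> \<le> \<epsilon>" using \<epsilon> B by (simp add: e_def field_simps)
    finally show "\<bar>spec \<Phi> \<Lambda> f \<xi> - spec \<Phi> \<Lambda> f \<eta>\<bar> \<le> \<epsilon>" .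
  qed
qed

end

section \<open>Dobrushin contraction\<close>

definition depends_on :: "int set \<Rightarrow> ('e config \<Rightarrow> 'b) \<Rightarrow> bool" where
  "depends_on J f \<longleftrightarrow> (\<forall>\<xi> \<eta>. (\<forall>i\<in>J. \<xi> i = \<eta> i) \<longrightarrow> f \<xi> = f \<eta>)"

text \<open>A profile \<open>v\<close> bounds the oscillation of \<open>f\<close> at each site. Requiring the bound for configurations
  that differ at infinitely many sites builds continuity of \<open>f\<close> into the definition.\<close>

definition osc_bound :: "(int \<Rightarrow> real) \<Rightarrow> ('e config \<Rightarrow> real) \<Rightarrow> bool" where
  "osc_bound v f \<longleftrightarrow> (\<forall>k. 0 \<le> v k) \<and> v summable_on UNIV \<and>
     (\<forall>\<xi> \<eta>. \<bar>f \<xi> - f \<eta>\<bar> \<le> infsum v {k. \<xi> k \<noteq> \<eta> k})"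

lemma depends_onD: "depends_on J f \<Longrightarrow> (\<And>i. i \<in> J \<Longrightarrow> \<xi> i = \<eta> i) \<Longrightarrow> f \<xi> = f \<eta>"
  by (simp add: depends_on_def)

lemma depends_on_restrict: "depends_on J f \<Longrightarrow> f (restrict \<omega> J) = f \<omega>"
  by (rule depends_onD) auto

lemma depends_on_indicator:
  "(\<And>\<xi> \<eta>. (\<forall>i\<in>J. \<xi> i = \<eta> i) \<Longrightarrow> \<xi> \<in> S \<Longrightarrow> \<eta> \<in> S) \<Longrightarrow> depends_on J (indicator S :: _ \<Rightarrow> real)"
  unfolding depends_on_def
proof (intro allI impI)
  fix \<xi> \<eta> :: "int \<Rightarrow> 'a"
  assume S: "\<And>\<xi> \<eta>. (\<forall>i\<in>J. \<xi> i = \<eta> i) \<Longrightarrow> \<xi> \<in> S \<Longrightarrow> \<eta> \<in> S" and eq: "\<forall>i\<in>J. \<xi> i = \<eta> i"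
  have "\<xi> \<in> S \<longleftrightarrow> \<eta> \<in> S" using S[OF eq] S[of \<eta> \<xi>] eq by auto
  then show "indicator S \<xi> = (indicator S \<eta> :: real)" by (simp add: indicator_def)
qed

lemma depends_on_bounded:
  fixes f :: "('e::finite) config \<Rightarrow> real"
  assumes "finite J" "depends_on J f"
  obtains B where "\<And>\<omega>. \<bar>f \<omega>\<bar> \<le> B"
proof
  fix \<omega>
  have "f \<omega> = f (restrict \<omega> J)" by (rule depends_on_restrict[OF assms(2), symmetric])
  moreover have "\<bar>f (restrict \<omega> J)\<bar> \<le> Max ((\<lambda>\<omega>. \<bar>f \<omega>\<bar>) ` patterns J)"
    by (rule Max_ge) (auto simp: finite_patterns assms(1))
  ultimately show "\<bar>f \<omega>\<bar> \<le> Max ((\<lambda>\<omega>. \<bar>f \<omega>\<bar>) ` patterns J)" by simp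
qed

lemma depends_on_osc_bound:
  fixes f :: "('e::finite) config \<Rightarrow> real"
  assumes "finite J" "depends_on J f"
  obtains v where "osc_bound v f"
proof -
  obtain B where B: "\<And>\<omega>. \<bar>f \<omega>\<bar> \<le> B" using depends_on_bounded[OF assms] by blast
  define v where "v k = (if k \<in> J then 2 * B else 0)" for k
  have B0: "0 \<le> B" using B[of undefined] by simp
  have v: "v summable_on A" for A
    by (rule finite_nonzero_values_imp_summable_on)
      (rule finite_subset[OF _ assms(1)], auto simp: v_def)
  have "osc_bound v f"
    unfolding osc_bound_def
  proof (intro conjI allI v)
    show "0 \<le> v k" for k using B0 by (simp add: v_def)
    fix \<xi> \<eta> :: "'e config"
    show "\<bar>f \<xi> - f \<eta>\<bar> \<le> infsum v {k. \<xi> k \<noteq> \<eta> k}"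
    proof (cases "\<forall>i\<in>J. \<xi> i = \<eta> i")
      case True
      then have "f \<xi> = f \<eta>" using assms(2) unfolding depends_on_def by blast
      then show ?thesis using B0 by (auto intro!: infsum_nonneg simp: v_def)
    next
      case False
      then obtain i where i: "i \<in> J" "\<xi> i \<noteq> \<eta> i" by blast
      have "\<bar>f \<xi> - f \<eta>\<bar> \<le> sum v {i}" using B[of \<xi>] B[of \<eta>] i by (simp add: v_def)
      also have "\<dots> \<le> infsum v {k. \<xi> k \<noteq> \<eta> k}"
        by (rule finite_sum_le_infsum[OF v]) (use i B0 in \<open>auto simp: v_def\<close>)
      finally show ?thesis .
    qed
  qed
  then show ?thesis by (rule that)
qed

lemma osc_bound_total:
  assumes "osc_bound v f" shows "\<bar>f \<xi> - f \<eta>\<bar> \<le> infsum v UNIV"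
proof -
  have "\<bar>f \<xi> - f \<eta>\<bar> \<le> infsum v {k. \<xi> k \<noteq> \<eta> k}" using assms by (simp add: osc_bound_def)
  also have "\<dots> \<le> infsum v UNIV"
    using assms unfolding osc_bound_def
    by (intro infsum_mono2) (auto intro: summable_on_subset_banach)
  finally show ?thesis .
qed

locale dobrushin_interaction = uac_interaction +
  assumes dobrushin: "dobrushin_c \<Phi> < 1"
begin

definition dob_c where "dob_c = enn2real (dobrushin_c \<Phi>)"

lemma dob_c_less_1: "dob_c < 1" and dob_c_nonneg: "0 \<le> dob_c"
proof -
  have "dobrushin_c \<Phi> < top" using dobrushin by (rule order.strict_trans) simp
  then show "dob_c < 1" using dobrushin unfolding dob_c_def by simp
qed (simp add: dob_c_def)

lemma card_touching: "V \<in> touching {i} \<Longrightarrow> 1 \<le> card V"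
  by (auto simp: touching_def Suc_le_eq card_gt_0_iff)

lemma weighted_osc:
  "(\<lambda>V. (real (card V) - 1) * osc (\<Phi> V)) summable_on touching {i}" (is ?A)
  "infsum (\<lambda>V. (real (card V) - 1) * osc (\<Phi> V)) (touching {i}) \<le> 2 * dob_c" (is ?B)
proof -
  let ?f = "\<lambda>V. (real (card V) - 1) * osc (\<Phi> V)"
  let ?s = "SUP i::int. infsum (\<lambda>V. ennreal (?f V)) {V. finite V \<and> i \<in> V}"
  have "ennreal dob_c = dobrushin_c \<Phi>"
    using dobrushin unfolding dob_c_def by (intro ennreal_enn2real) (auto intro: order.strict_trans)
  then have "2 * (1 / 2 * ?s) = ennreal (2 * dob_c)"
    unfolding dobrushin_c_def using dob_c_nonneg by (simp add: ennreal_mult)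
  moreover have "2 * (1 / 2 * ?s) = ?s"
    by (simp add: mult.assoc[symmetric] ennreal_times_divide)
  moreover have "infsum (\<lambda>V. ennreal (?f V)) (touching {i}) \<le> ?s"
    by (rule SUP_upper2[of i]) (auto simp: touching_def)
  ultimately have le: "infsum (\<lambda>V. ennreal (?f V)) (touching {i}) \<le> ennreal (2 * dob_c)" by simp
  have nn: "0 \<le> ?f V" if "V \<in> touching {i}" for V
    using card_touching[OF that] that osc_nonneg[of V] by (auto simp: touching_def)
  show ?A ?B
    using summable_on_if_ennreal_infsum_le[OF nn le] dob_c_nonneg by auto
qed

text \<open>An upper bound for Dobrushin's interdependence coefficient: the total variation distance of
  the conditional laws at \<open>i\<close> when only the spin at \<open>j\<close> changes.\<close>

definition influence :: "int \<Rightarrow> int \<Rightarrow> real" where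
  "influence i j = infsum (\<lambda>V. if j \<in> V \<and> j \<noteq> i then osc (\<Phi> V) else 0) (touching {i}) / 2"

lemma influence_nonneg: "0 \<le> influence i j"
  unfolding influence_def by (auto intro!: divide_nonneg_pos infsum_nonneg osc_nonneg simp: touching_def)

lemma influence_self: "influence i i = 0"
  by (simp add: influence_def)

text \<open>Exchange of the sums over sets \<open>V\<close> and over sites: a set containing
  \<open>i\<close> is counted once for each of its other \<open>card V - 1\<close> sites, which is
  its weight in the Dobrushin sum. The last claim is a union bound, since a set meeting
  \<open>D\<close> is counted at least once there.\<close>

lemma influence_row:
  shows "influence i summable_on UNIV"
    and "infsum (influence i) UNIV \<le> dob_c"
    and "\<And>D. i \<notin> D \<Longrightarrow>
      infsum (\<lambda>V. if V \<inter> D \<noteq> {} then osc (\<Phi> V) else 0) (touching {i}) \<le> 2 * infsum (influence i) D"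
proof -
  \<comment> \<open>Summing over \<open>V\<close> gives twice \<open>influence i k\<close>; summing
    over \<open>k\<close> gives the term of \<open>V\<close> in the Dobrushin sum.\<close>
  define g where "g V k = (if k \<in> V \<and> k \<noteq> i then osc (\<Phi> V) else 0)" for V k
  let ?T = "touching {i}"
  have gnn: "0 \<le> g V k" if "V \<in> ?T" for V k
    using that osc_nonneg by (simp add: g_def touching_def)
  have gs: "g V summable_on D" if "V \<in> ?T" for V D
    by (rule finite_nonzero_values_imp_summable_on)
      (rule finite_subset[of _ V], use that in \<open>auto simp: g_def touching_def\<close>)
  have gsum: "infsum (g V) UNIV = (real (card V) - 1) * osc (\<Phi> V)" if V: "V \<in> ?T" for V
  proof -
    have "infsum (g V) UNIV = infsum (g V) (V - {i})"
      by (rule infsum_cong_neutral) (auto simp: g_def)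
    also have "\<dots> = (\<Sum>k\<in>V - {i}. osc (\<Phi> V))"
      using V by (subst infsum_finite) (auto simp: touching_def g_def intro!: sum.cong)
    also have "\<dots> = (real (card V) - 1) * osc (\<Phi> V)"
      using V card_touching[OF V] by (simp add: touching_def card_Diff_singleton of_nat_diff)
    finally show ?thesis .
  qed
  have sT: "(\<lambda>(V, k). g V k) summable_on ?T \<times> UNIV"
  proof (rule summable_on_SigmaI)
    show "((\<lambda>k. case (V, k) of (V, k) \<Rightarrow> g V k) has_sum (real (card V) - 1) * osc (\<Phi> V)) UNIV"
      if "V \<in> ?T" for V
      using has_sum_infsum[OF gs[OF that, of UNIV]] gsum[OF that] by simp
  qed (use weighted_osc(1) gnn in auto)
  have sD: "(\<lambda>(V, k). g V k) summable_on ?T \<times> D" for D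
    by (rule summable_on_subset_banach[OF sT]) auto
  have sD': "(\<lambda>(k, V). g V k) summable_on D \<times> ?T" for D
    using sD[of D] by (subst summable_on_swap) (simp add: case_prod_unfold)
  have infl: "influence i k = infsum (\<lambda>V. g V k) ?T / 2" for k
    by (simp add: influence_def g_def)
  have colsum: "(\<lambda>k. infsum (\<lambda>V. g V k) ?T) summable_on D" for D
    using summable_on_Sigma_banach[OF sD'[of D]] by simp
  show s: "influence i summable_on UNIV"
    unfolding infl using summable_on_cmult_left[OF colsum[of UNIV], of "1/2"] by simp
  have two: "2 * infsum (influence i) D = infsum (\<lambda>V. infsum (g V) D) ?T" for D
  proof -
    have "infsum (influence i) D = infsum (\<lambda>k. infsum (\<lambda>V. g V k) ?T * (1/2)) D"
      by (rule infsum_cong) (simp add: infl)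
    also have "\<dots> = infsum (\<lambda>k. infsum (\<lambda>V. g V k) ?T) D * (1/2)"
      by (rule infsum_cmult_left) (simp add: colsum)
    also have "infsum (\<lambda>k. infsum (\<lambda>V. g V k) ?T) D = infsum (\<lambda>V. infsum (g V) D) ?T"
      by (rule infsum_swap_banach[OF sD[of D], symmetric])
    finally show ?thesis by simp
  qed
  have "infsum (\<lambda>V. infsum (g V) UNIV) ?T = infsum (\<lambda>V. (real (card V) - 1) * osc (\<Phi> V)) ?T"
    by (rule infsum_cong) (rule gsum)
  then show "infsum (influence i) UNIV \<le> dob_c"
    using two[of UNIV] weighted_osc(2)[of i] by simp
  fix D assume D: "i \<notin> D"
  have le: "(if V \<inter> D \<noteq> {} then osc (\<Phi> V) else 0) \<le> infsum (g V) D" if V: "V \<in> ?T" for V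
  proof (cases "V \<inter> D = {}")
    case False
    then obtain k where k: "k \<in> V" "k \<in> D" by blast
    then have "osc (\<Phi> V) = sum (g V) {k}" using D by (auto simp: g_def)
    also have "\<dots> \<le> infsum (g V) D"
      by (rule finite_sum_le_infsum[OF gs[OF V]]) (use k gnn[OF V] in auto)
    finally show ?thesis using False by simp
  qed (auto intro: infsum_nonneg gnn[OF V])
  have "(\<lambda>V. infsum (g V) D) summable_on ?T"
    using summable_on_Sigma_banach[OF sD[of D]] by simp
  moreover from this have "(\<lambda>V. if V \<inter> D \<noteq> {} then osc (\<Phi> V) else 0) summable_on ?T"
    by (rule summable_on_if_abs_le) (use le osc_nonneg in \<open>fastforce simp: touching_def\<close>)
  ultimately show "infsum (\<lambda>V. if V \<inter> D \<noteq> {} then osc (\<Phi> V) else 0) ?T \<le> 2 * infsum (influence i) D"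
    unfolding two by (intro infsum_mono le)
qed

text \<open>Only potentials whose set contains \<open>i\<close> and meets \<open>D\<close> can
  change, each by at most its oscillation. The factor 2 undoes the halving in
  \<open>influence\<close>.\<close>

lemma hamiltonian_single_site_diff:
  assumes "i \<notin> D" "\<And>k. k \<notin> D \<Longrightarrow> \<xi> k = \<eta> k"
  shows "\<bar>hamiltonian \<Phi> {i} \<xi> - hamiltonian \<Phi> {i} \<eta>\<bar> \<le> 2 * infsum (influence i) D"
proof -
  let ?o = "\<lambda>V. if V \<inter> D \<noteq> {} then osc (\<Phi> V) else 0"
  have le: "\<bar>\<Phi> V \<xi> - \<Phi> V \<eta>\<bar> \<le> ?o V" if "V \<in> touching {i}" for V
  proof (cases "V \<inter> D = {}")
    case True
    then have "\<Phi> V \<xi> = \<Phi> V \<eta>" using that assms by (intro potential_cong) (auto simp: touching_def)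
    then show ?thesis using True by simp
  next
    case False
    then show ?thesis using that potential_diff_le_osc by (simp add: touching_def)
  qed
  have so: "?o summable_on touching {i}"
  proof (rule summable_on_if_abs_le)
    show "(\<lambda>V. 2 * sup_norm (\<Phi> V)) summable_on touching {i}"
      by (intro summable_on_cmult_right summable_sup_norm) simp
    show "\<bar>?o V\<bar> \<le> 2 * sup_norm (\<Phi> V)" if "V \<in> touching {i}" for V
      using that osc_le_sup_norm[of V] osc_nonneg[of V] sup_norm_nonneg[of V]
      by (auto simp: touching_def)
  qed
  have sd: "(\<lambda>V. \<Phi> V \<xi> - \<Phi> V \<eta>) summable_on touching {i}"
    using summable_on_if_abs_le[OF so] le by simp
  have "\<bar>hamiltonian \<Phi> {i} \<xi> - hamiltonian \<Phi> {i} \<eta>\<bar> \<le> infsum ?o (touching {i})"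
    unfolding hamiltonian_diff[OF finite.insertI[OF finite.emptyI]] real_norm_def[symmetric]
    by (rule norm_infsum_le[OF has_sum_infsum[OF sd] has_sum_infsum[OF so]]) (use le in simp)
  also have "\<dots> \<le> 2 * infsum (influence i) D" using assms(1) by (rule influence_row(3))
  finally show ?thesis .
qed

text \<open>The profile after resampling site \<open>i\<close>: the old spin there is forgotten, and
  its oscillation is handed to the sites on which the new spin depends.\<close>

definition propagate :: "int \<Rightarrow> (int \<Rightarrow> real) \<Rightarrow> int \<Rightarrow> real" where
  "propagate i v j = (if j = i then 0 else v j + influence i j * v i)"

text \<open>Two configurations are updated with a common pattern at \<open>i\<close>: what remains
  of the direct difference is \<open>v\<close> off \<open>i\<close>, and the change of the
  conditional law acts on an observable of oscillation \<open>v i\<close>. In total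
  \<open>v i\<close> is lost, while the row sum of \<open>influence\<close> returns at most
  \<open>dob_c * v i\<close>.\<close>

lemma osc_bound_propagate:
  assumes "osc_bound v f"
  shows "osc_bound (propagate i v) (spec \<Phi> {i} f)" (is ?A)
    and "infsum (propagate i v) UNIV \<le> infsum v UNIV - (1 - dob_c) * v i" (is ?B)
proof -
  have vnn: "\<And>k. 0 \<le> v k" and vs: "v summable_on UNIV"
    and vf: "\<And>\<xi> \<eta>. \<bar>f \<xi> - f \<eta>\<bar> \<le> infsum v {k. \<xi> k \<noteq> \<eta> k}"
    using assms by (auto simp: osc_bound_def)
  have vsub: "v summable_on A" for A
    using summable_on_subset_banach[OF vs] by simp
  have isub: "influence i summable_on A" for A
    using summable_on_subset_banach[OF influence_row(1)] by simp
  have imul: "(\<lambda>j. influence i j * v i) summable_on A" for A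
    by (intro summable_on_cmult_left isub)
  have dsum: "(\<lambda>j. v j + influence i j * v i) summable_on A" for A
    by (intro summable_on_add vsub imul)
  have dcong: "infsum (propagate i v) A = infsum v (A - {i}) + infsum (influence i) (A - {i}) * v i" for A
  proof -
    have "infsum (propagate i v) A = infsum (\<lambda>j. v j + influence i j * v i) (A - {i})"
      by (rule infsum_cong_neutral) (auto simp: propagate_def)
    then show ?thesis by (simp add: infsum_add[OF vsub imul] infsum_cmult_left[OF isub])
  qed
  show ?A
    unfolding osc_bound_def
  proof (intro conjI allI)
    show "0 \<le> propagate i v k" for k using vnn influence_nonneg by (simp add: propagate_def)
    show "propagate i v summable_on UNIV"
      using dsum[of "UNIV - {i}"] by (rule summable_on_cong_neutral[THEN iffD1, rotated -1]) (auto simp: propagate_def)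
    fix \<xi> \<eta> :: "'a config"
    let ?D = "{k. \<xi> k \<noteq> \<eta> k} - {i}"
    \<comment> \<open>The 4 arises from two energy differences, each at most twice the influence
      sum. It cancels the quarter of the covariance estimate.\<close>
    have "\<bar>spec \<Phi> {i} f \<xi> - spec \<Phi> {i} f \<eta>\<bar>
        \<le> infsum v ?D + (4 * infsum (influence i) ?D) * v i / 4"
    proof (rule spec_compare)
      fix x y :: "'a config"
      have "{k. override_on \<xi> x {i} k \<noteq> override_on \<eta> x {i} k} = ?D"
        by (auto simp: override_on_def)
      then show "\<bar>f (override_on \<xi> x {i}) - f (override_on \<eta> x {i})\<bar> \<le> infsum v ?D"
        using vf[of "override_on \<xi> x {i}" "override_on \<eta> x {i}"] by simp
      have "\<bar>f (override_on \<eta> x {i}) - f (override_on \<eta> y {i})\<bar>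
         \<le> infsum v {k. override_on \<eta> x {i} k \<noteq> override_on \<eta> y {i} k}" by (rule vf)
      also have "\<dots> \<le> infsum v {i}"
        by (rule infsum_mono2[OF vsub vsub]) (auto simp: override_on_def vnn split: if_splits)
      finally show "\<bar>f (override_on \<eta> x {i}) - f (override_on \<eta> y {i})\<bar> \<le> v i" by simp
      have "\<bar>hamiltonian \<Phi> {i} (override_on \<xi> z {i}) - hamiltonian \<Phi> {i} (override_on \<eta> z {i})\<bar>
          \<le> 2 * infsum (influence i) ?D" for z
        by (rule hamiltonian_single_site_diff) (auto simp: override_on_def)
      from this[of x] this[of y]
      show "\<bar>(hamiltonian \<Phi> {i} (override_on \<xi> x {i}) - hamiltonian \<Phi> {i} (override_on \<eta> x {i}))
          - (hamiltonian \<Phi> {i} (override_on \<xi> y {i}) - hamiltonian \<Phi> {i} (override_on \<eta> y {i}))\<bar>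
          \<le> 4 * infsum (influence i) ?D" by linarith
    qed simp
    then show "\<bar>spec \<Phi> {i} f \<xi> - spec \<Phi> {i} f \<eta>\<bar> \<le> infsum (propagate i v) {k. \<xi> k \<noteq> \<eta> k}"
      by (simp add: dcong)
  qed
  have "infsum v UNIV = v i + infsum v (UNIV - {i})"
    using infsum_Un_disjoint[OF vsub[of "{i}"] vsub[of "UNIV - {i}"]] by simp
  moreover have "infsum (influence i) (UNIV - {i}) = infsum (influence i) UNIV"
    by (rule infsum_cong_neutral) (auto simp: influence_self)
  moreover have "infsum (influence i) UNIV * v i \<le> dob_c * v i"
    using influence_row(2) vnn by (rule mult_right_mono)
  ultimately show ?B by (simp add: dcong algebra_simps)
qed

text \<open>The last site of the list acts first on \<open>f\<close>, so prepending a site means one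
  further update of the observable already obtained.\<close>

definition sweep :: "int list \<Rightarrow> ('a config \<Rightarrow> real) \<Rightarrow> 'a config \<Rightarrow> real" where
  "sweep is = foldr (\<lambda>i. spec \<Phi> {i}) is"

lemma sweep_simps [simp]:
  "sweep [] f = f" "sweep (i # is) f = spec \<Phi> {i} (sweep is f)"
  "sweep (is @ js) f = sweep is (sweep js f)"
  by (simp_all add: sweep_def)

text \<open>Sites not yet visited only gain oscillation, so a visit to \<open>i\<close> removes at least
  \<open>(1 - dob_c) * v i\<close>.\<close>

lemma osc_bound_sweep_set:
  assumes "osc_bound v f" "finite F"
  shows "\<exists>is v'. osc_bound v' (sweep is f) \<and> (\<forall>j. j \<notin> F \<longrightarrow> v j \<le> v' j) \<and>
    infsum v' UNIV \<le> infsum v UNIV - (1 - dob_c) * sum v F"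
  using assms(2)
proof induction
  case empty
  show ?case by (rule exI[of _ "[]"], rule exI[of _ v]) (simp add: assms(1))
next
  case (insert i F)
  then obtain "is" v' where IH: "osc_bound v' (sweep is f)" "\<And>j. j \<notin> F \<Longrightarrow> v j \<le> v' j"
    "infsum v' UNIV \<le> infsum v UNIV - (1 - dob_c) * sum v F" by blast
  have nn: "0 \<le> v' k" for k using IH(1) by (simp add: osc_bound_def)
  have "v j \<le> propagate i v' j" if "j \<notin> insert i F" for j
    using that IH(2)[of j] influence_nonneg[of i j] nn[of i] by (simp add: propagate_def add_increasing2)
  moreover have "infsum (propagate i v') UNIV \<le> infsum v UNIV - (1 - dob_c) * sum v (insert i F)"
  proof -
    have "(1 - dob_c) * v i \<le> (1 - dob_c) * v' i"
      using IH(2)[of i] insert.hyps dob_c_less_1 by (intro mult_left_mono) auto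
    then show ?thesis
      using osc_bound_propagate(2)[OF IH(1), of i] IH(3) insert.hyps by (simp add: algebra_simps)
  qed
  ultimately show ?case
    using osc_bound_propagate(1)[OF IH(1), of i]
    by (intro exI[of _ "i # is"] exI[of _ "propagate i v'"]) simp
qed

text \<open>A finite set of sites carries at least half of the total oscillation. Sweeping it
  removes the fraction \<open>1 - dob_c\<close> of that half, which leaves the factor
  \<open>(1 + dob_c) / 2 < 1\<close>.\<close>

lemma osc_bound_contract:
  assumes "osc_bound v f"
  shows "\<exists>is v'. osc_bound v' (sweep is f) \<and> infsum v' UNIV \<le> (1 + dob_c) / 2 * infsum v UNIV"
proof -
  have vnn: "\<And>k. 0 \<le> v k" and vs: "v summable_on UNIV"
    using assms by (auto simp: osc_bound_def)
  have "\<exists>F. finite F \<and> infsum v UNIV / 2 \<le> sum v F"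
  proof (cases "infsum v UNIV = 0")
    case True
    then show ?thesis by (intro exI[of _ "{}"]) simp
  next
    case False
    moreover have "0 \<le> infsum v UNIV" using vnn by (rule infsum_nonneg)
    ultimately have "0 < infsum v UNIV / 2" by simp
    from infsum_finite_approximation[OF vs this] obtain F where
      "finite F" "dist (sum v F) (infsum v UNIV) \<le> infsum v UNIV / 2" by auto
    then show ?thesis unfolding dist_real_def by (intro exI[of _ F]) linarith
  qed
  then obtain F where F: "finite F" "infsum v UNIV / 2 \<le> sum v F" by blast
  obtain "is" v' where *: "osc_bound v' (sweep is f)"
    "infsum v' UNIV \<le> infsum v UNIV - (1 - dob_c) * sum v F"
    using osc_bound_sweep_set[OF assms F(1)] by blast
  have "(1 - dob_c) * (infsum v UNIV / 2) \<le> (1 - dob_c) * sum v F"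
    using F(2) dob_c_less_1 by (intro mult_left_mono) auto
  with *(2) have "infsum v' UNIV \<le> (1 + dob_c) / 2 * infsum v UNIV" by (simp add: field_simps)
  with *(1) show ?thesis by blast
qed

lemma osc_bound_contract_iterate:
  assumes "osc_bound v f"
  shows "\<exists>is v'. osc_bound v' (sweep is f) \<and> infsum v' UNIV \<le> ((1 + dob_c) / 2) ^ n * infsum v UNIV"
proof (induction n)
  case 0
  show ?case by (rule exI[of _ "[]"], rule exI[of _ v]) (simp add: assms(1))
next
  case (Suc n)
  then obtain "is" v' where IH: "osc_bound v' (sweep is f)"
    "infsum v' UNIV \<le> ((1 + dob_c) / 2) ^ n * infsum v UNIV" by blast
  obtain js w where w: "osc_bound w (sweep js (sweep is f))"
    "infsum w UNIV \<le> (1 + dob_c) / 2 * infsum v' UNIV"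
    using osc_bound_contract[OF IH(1)] by blast
  note w(2)
  also have "(1 + dob_c) / 2 * infsum v' UNIV \<le> (1 + dob_c) / 2 * (((1 + dob_c) / 2) ^ n * infsum v UNIV)"
    using IH(2) dob_c_nonneg by (intro mult_left_mono) auto
  finally show ?case
    using w(1) by (intro exI[of _ "js @ is"] exI[of _ w]) (simp add: mult.assoc)
qed

lemma sweep_almost_constant:
  assumes "osc_bound v f" "\<epsilon> > 0"
  obtains "is" where "\<And>\<xi> \<eta>. \<bar>sweep is f \<xi> - sweep is f \<eta>\<bar> \<le> \<epsilon>"
proof -
  have "(\<lambda>n. ((1 + dob_c) / 2) ^ n * infsum v UNIV) \<longlonglongrightarrow> 0 * infsum v UNIV"
    using dob_c_less_1 dob_c_nonneg by (intro tendsto_intros LIMSEQ_realpow_zero) auto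
  then have "eventually (\<lambda>n. ((1 + dob_c) / 2) ^ n * infsum v UNIV < \<epsilon>) sequentially"
    using assms(2) by (intro order_tendstoD) auto
  then obtain n where n: "((1 + dob_c) / 2) ^ n * infsum v UNIV < \<epsilon>"
    using eventually_happens by force
  obtain "is" v' where *: "osc_bound v' (sweep is f)"
    "infsum v' UNIV \<le> ((1 + dob_c) / 2) ^ n * infsum v UNIV"
    using osc_bound_contract_iterate[OF assms(1)] by blast
  show ?thesis
  proof
    show "\<bar>sweep is f \<xi> - sweep is f \<eta>\<bar> \<le> \<epsilon>" for \<xi> \<eta>
      using osc_bound_total[OF *(1), of \<xi> \<eta>] *(2) n by linarith
  qed
qed

text \<open>By consistency a larger volume absorbs every single-site update inside it. A
  finite-volume average of \<open>f\<close> is therefore also the average of an almost constant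
  function.\<close>

lemma spec_sweep:
  "set is \<subseteq> \<Lambda> \<Longrightarrow> finite \<Lambda> \<Longrightarrow> spec \<Phi> \<Lambda> (sweep is f) = spec \<Phi> \<Lambda> f"
proof (induction "is")
  case (Cons i "is")
  then show ?case by (auto intro!: ext simp: spec_consistent)
qed simp

end

section \<open>Uniqueness of the Gibbs measure\<close>

lemma space_cfgM: "space cfgM = UNIV"
  by (simp add: cfgM_def space_PiM)

lemma measurable_coordinate: "(\<lambda>\<omega>. \<omega> i) \<in> cfgM \<rightarrow>\<^sub>M count_space UNIV"
  unfolding cfgM_def by (rule measurable_component_singleton) simp

lemma measurable_override: "(\<lambda>\<omega>. override_on \<omega> x \<Lambda>) \<in> cfgM \<rightarrow>\<^sub>M cfgM"
proof -
  have "(\<lambda>\<omega>. override_on \<omega> x \<Lambda> i) \<in> cfgM \<rightarrow>\<^sub>M count_space UNIV" for i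
    using measurable_coordinate by (cases "i \<in> \<Lambda>") auto
  then show ?thesis
    unfolding cfgM_def[where ?'e = 'a] by (intro measurable_PiM_single') (auto simp: cfgM_def)
qed

definition cyl :: "int set \<Rightarrow> 'e config \<Rightarrow> 'e config set" where
  "cyl J x = {\<omega>. \<forall>i\<in>J. \<omega> i = x i}"

lemma sets_cyl: "finite J \<Longrightarrow> cyl J x \<in> sets cfgM"
proof -
  assume "finite J"
  then have "{\<omega> \<in> space cfgM. \<forall>i\<in>J. \<omega> i \<in> {x i}} \<in> sets cfgM"
    by (intro sets.sets_Collect_finite_All measurable_sets_Collect[OF measurable_coordinate])
      (auto intro: finite_subset)
  then show ?thesis by (simp add: cyl_def space_cfgM)
qed

lemma depends_on_eq_sum:
  fixes f :: "('e::finite) config \<Rightarrow> real"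
  assumes "finite J" "depends_on J f"
  shows "f \<omega> = (\<Sum>x\<in>patterns J. f x * indicator (cyl J x) \<omega>)"
proof -
  have "(\<Sum>x\<in>patterns J. f x * indicator (cyl J x) \<omega>) = (\<Sum>x\<in>{restrict \<omega> J}. f x * indicator (cyl J x) \<omega>)"
  proof (rule sum.mono_neutral_right[OF finite_patterns[OF assms(1)]])
    show "\<forall>x\<in>patterns J - {restrict \<omega> J}. f x * indicator (cyl J x) \<omega> = 0"
    proof
      fix x assume x: "x \<in> patterns J - {restrict \<omega> J}"
      have "\<omega> \<notin> cyl J x"
      proof
        assume "\<omega> \<in> cyl J x"
        then have "x = restrict \<omega> J" using x by (intro PiE_ext[of x J "\<lambda>_. UNIV"]) (auto simp: cyl_def)
        then show False using x by simp
      qed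
      then show "f x * indicator (cyl J x) \<omega> = 0" by simp
    qed
  qed simp
  also have "\<dots> = f (restrict \<omega> J)" by (simp add: cyl_def)
  also have "\<dots> = f \<omega>" by (rule depends_on_restrict[OF assms(2)])
  finally show ?thesis ..
qed

lemma depends_on_measurable:
  fixes f :: "('e::finite) config \<Rightarrow> real"
  assumes "finite J" "depends_on J f"
  shows "f \<in> borel_measurable cfgM"
proof -
  have "f = (\<lambda>\<omega>. \<Sum>x\<in>patterns J. f x * indicator (cyl J x) \<omega>)"
    by (rule ext) (rule depends_on_eq_sum[OF assms])
  also have "\<dots> \<in> borel_measurable cfgM"
    by (intro borel_measurable_sum borel_measurable_times borel_measurable_const
        borel_measurable_indicator sets_cyl assms)
  finally show ?thesis .
qed

lemma depends_on_quasilocal: "finite J \<Longrightarrow> depends_on J f \<Longrightarrow> quasilocal f"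
  unfolding quasilocal_def depends_on_def by (metis abs_zero cancel_comm_monoid_add_class.diff_cancel less_imp_le)

lemma quasilocal_approx:
  assumes "quasilocal f" "\<epsilon> > 0"
  obtains J g where "finite J" "depends_on J g" "\<And>\<omega>. \<bar>f \<omega> - g \<omega>\<bar> \<le> \<epsilon>"
proof -
  obtain J where J: "finite J" "\<And>\<xi> \<eta>. (\<forall>i\<in>J. \<xi> i = \<eta> i) \<Longrightarrow> \<bar>f \<xi> - f \<eta>\<bar> \<le> \<epsilon>"
    using assms unfolding quasilocal_def by blast
  show ?thesis
  proof
    show "finite J" by fact
    show "depends_on J (\<lambda>\<omega>. f (restrict \<omega> J))"
      unfolding depends_on_def
    proof (intro allI impI arg_cong[where f = f])
      show "restrict \<xi> J = restrict \<eta> J" if "\<forall>i\<in>J. \<xi> i = \<eta> i" for \<xi> \<eta> :: "'a config"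
        using that by (auto simp: restrict_def)
    qed
    show "\<bar>f \<omega> - f (restrict \<omega> J)\<bar> \<le> \<epsilon>" for \<omega> by (rule J(2)) simp
  qed
qed

text \<open>Local functions are measurable because there are finitely many patterns on a finite set,
  and a quasilocal function is a uniform limit of local ones.\<close>

lemma quasilocal_measurable:
  fixes f :: "('e::finite) config \<Rightarrow> real"
  assumes "quasilocal f" shows "f \<in> borel_measurable cfgM"
proof -
  have "\<exists>g. g \<in> borel_measurable cfgM \<and> (\<forall>\<omega>. \<bar>f \<omega> - g \<omega>\<bar> \<le> inverse (real (Suc n)))" for n
    by (rule quasilocal_approx[OF assms, of "inverse (real (Suc n))"]) (auto intro: depends_on_measurable)
  then obtain g where g: "\<And>n. g n \<in> borel_measurable cfgM"
    "\<And>n \<omega>. \<bar>f \<omega> - g n \<omega>\<bar> \<le> inverse (real (Suc n))" by metis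
  show ?thesis
  proof (rule borel_measurable_LIMSEQ_real[OF _ g(1)])
    fix \<omega>
    have "(\<lambda>n. f \<omega> - g n \<omega>) \<longlonglongrightarrow> 0"
      by (rule Lim_null_comparison[OF _ LIMSEQ_inverse_real_of_nat]) (use g(2) in auto)
    from tendsto_diff[OF tendsto_const[of "f \<omega>"] this] show "(\<lambda>n. g n \<omega>) \<longlonglongrightarrow> f \<omega>" by simp
  qed
qed

lemma (in prob_space) abs_integral_diff_le:
  fixes g :: "'a \<Rightarrow> real"
  assumes "g \<in> borel_measurable M" "\<And>\<omega>. \<bar>g \<omega> - a\<bar> \<le> e"
  shows "\<bar>(\<integral>\<omega>. g \<omega> \<partial>M) - a\<bar> \<le> e"
proof -
  have b: "\<bar>g \<omega>\<bar> \<le> \<bar>a\<bar> + e" for \<omega> using assms(2)[of \<omega>] by linarith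
  have "integrable M g"
    by (rule integrable_const_bound[of _ "\<bar>a\<bar> + e"]) (use b assms in auto)
  moreover have "a - e \<le> g \<omega>" "g \<omega> \<le> a + e" for \<omega> using assms(2)[of \<omega>] by linarith+
  ultimately have "a - e \<le> (\<integral>\<omega>. g \<omega> \<partial>M)" "(\<integral>\<omega>. g \<omega> \<partial>M) \<le> a + e"
    by (auto intro: integral_ge_const integral_le_const)
  then show ?thesis by linarith
qed

context uac_interaction
begin

lemma hamiltonian_measurable: "finite \<Lambda> \<Longrightarrow> hamiltonian \<Phi> \<Lambda> \<in> borel_measurable cfgM"
  by (intro quasilocal_measurable quasilocal_hamiltonian)

text \<open>The conditional probability of the pattern \<open>x\<close> as a function of the
  boundary. Sums over the fixed index set \<open>patterns \<Lambda>\<close> replace sums over the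
  set \<open>agree_out \<Lambda> \<eta>\<close>, which varies with the integration variable.\<close>

definition weight :: "int set \<Rightarrow> 'e config \<Rightarrow> 'e config \<Rightarrow> real" where
  "weight \<Lambda> x \<eta> = exp (- hamiltonian \<Phi> \<Lambda> (override_on \<eta> x \<Lambda>))
     / (\<Sum>y\<in>patterns \<Lambda>. exp (- hamiltonian \<Phi> \<Lambda> (override_on \<eta> y \<Lambda>)))"

lemma weight_nonneg: "0 \<le> weight \<Lambda> x \<eta>"
  by (auto simp: weight_def intro!: divide_nonneg_nonneg sum_nonneg)

lemma spec_eq_sum: "spec \<Phi> \<Lambda> f \<eta> = (\<Sum>x\<in>patterns \<Lambda>. weight \<Lambda> x \<eta> * f (override_on \<eta> x \<Lambda>))"
  unfolding spec_def sum_agree_out weight_def sum_divide_distrib by (simp add: mult.commute)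

lemma measurable_comp_override:
  "f \<in> cfgM \<rightarrow>\<^sub>M N \<Longrightarrow> (\<lambda>\<eta>. f (override_on \<eta> x \<Lambda>)) \<in> cfgM \<rightarrow>\<^sub>M N"
  by (rule measurable_compose[OF measurable_override])

lemma weight_measurable: "finite \<Lambda> \<Longrightarrow> weight \<Lambda> x \<in> borel_measurable cfgM"
  using measurable_comp_override[OF hamiltonian_measurable[of \<Lambda>]]
  unfolding weight_def by measurable

lemma spec_measurable:
  "finite \<Lambda> \<Longrightarrow> f \<in> borel_measurable cfgM \<Longrightarrow> spec \<Phi> \<Lambda> f \<in> borel_measurable cfgM"
  unfolding spec_eq_sum[abs_def]
  by (intro borel_measurable_sum borel_measurable_times weight_measurable measurable_comp_override)

text \<open>The definition of \<open>gibbs\<close> speaks of events only. Induction over nonnegative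
  measurable functions (indicators, multiples, sums, monotone limits) extends the equation; the left
  side is the extended-real form of \<open>spec\<close>.\<close>

lemma nn_integral_spec:
  assumes g: "gibbs \<Phi> \<mu>" and \<Lambda>: "finite \<Lambda>" and f: "f \<in> borel_measurable cfgM"
  shows "(\<integral>\<^sup>+\<eta>. (\<Sum>x\<in>patterns \<Lambda>. ennreal (weight \<Lambda> x \<eta>) * f (override_on \<eta> x \<Lambda>)) \<partial>\<mu>)
       = (\<integral>\<^sup>+\<eta>. f \<eta> \<partial>\<mu>)"
proof -
  interpret prob_space \<mu> using g by (simp add: gibbs_def)
  have S: "sets \<mu> = sets cfgM" using g by (simp add: gibbs_def)
  have m: "h \<in> cfgM \<rightarrow>\<^sub>M N \<Longrightarrow> h \<in> \<mu> \<rightarrow>\<^sub>M N" for h :: "'e config \<Rightarrow> 'b" and N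
    using measurable_cong_sets[OF S refl] by blast
  have w: "(\<lambda>\<eta>. ennreal (weight \<Lambda> x \<eta>)) \<in> borel_measurable cfgM" for x
    using weight_measurable[OF \<Lambda>] by measurable
  let ?G = "\<lambda>f \<eta>. \<Sum>x\<in>patterns \<Lambda>. ennreal (weight \<Lambda> x \<eta>) * f (override_on \<eta> x \<Lambda>)"
  have Gm: "?G f \<in> borel_measurable \<mu>" if "f \<in> borel_measurable cfgM" for f
    by (intro m borel_measurable_sum borel_measurable_times_ennreal w measurable_comp_override that)
  show ?thesis using f
  proof induction
    case (cong f h)
    then have "f = h" by (auto simp: space_cfgM)
    with cong show ?case by simp
  next
    case (set A)
    have "?G (indicator A) \<eta> = ennreal (spec \<Phi> \<Lambda> (indicator A) \<eta>)" for \<eta>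
      unfolding spec_eq_sum
      by (subst sum_ennreal[symmetric])
        (auto simp: weight_nonneg simp del: sum_ennreal intro!: sum.cong split: split_indicator)
    then have "(\<integral>\<^sup>+\<eta>. ?G (indicator A) \<eta> \<partial>\<mu>) = (\<integral>\<^sup>+\<eta>. ennreal (spec \<Phi> \<Lambda> (indicator A) \<eta>) \<partial>\<mu>)"
      by simp
    also have "\<dots> = ennreal (\<integral>\<eta>. spec \<Phi> \<Lambda> (indicator A) \<eta> \<partial>\<mu>)"
    proof (rule nn_integral_eq_integral)
      have b: "\<bar>spec \<Phi> \<Lambda> (indicator A) \<eta>\<bar> \<le> 1" for \<eta>
        by (rule spec_abs_le[OF \<Lambda>]) (auto split: split_indicator)
      show "integrable \<mu> (spec \<Phi> \<Lambda> (indicator A))"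
        by (rule integrable_const_bound[of _ 1])
          (use b set in \<open>auto intro!: m spec_measurable \<Lambda>\<close>)
      have "0 \<le> spec \<Phi> \<Lambda> (indicator A) \<eta>" for \<eta>
        by (rule spec_between(1)[OF \<Lambda>, of _ _ _ 1]) (auto split: split_indicator)
      then show "AE \<eta> in \<mu>. 0 \<le> spec \<Phi> \<Lambda> (indicator A) \<eta>" by simp
    qed
    also have "\<dots> = ennreal (measure \<mu> A)"
      using g set \<Lambda> unfolding gibbs_def gibbs_kernel_eq_spec by auto
    also have "\<dots> = (\<integral>\<^sup>+\<eta>. indicator A \<eta> \<partial>\<mu>)"
      using set S by (simp add: emeasure_eq_measure)
    finally show ?case .
  next
    case (mult f a)
    have "?G (\<lambda>x. a * f x) \<eta> = a * ?G f \<eta>" for \<eta>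
      by (simp add: sum_distrib_left mult.left_commute)
    then show ?case
      using mult by (simp add: nn_integral_cmult Gm m)
  next
    case (add f h)
    have "?G (\<lambda>x. h x + f x) \<eta> = ?G h \<eta> + ?G f \<eta>" for \<eta>
      by (simp add: sum.distrib algebra_simps)
    then show ?case
      using add by (simp add: nn_integral_add Gm m)
  next
    case (seq U)
    have e: "?G (SUP i. U i) \<eta> = (SUP i. ?G (U i) \<eta>)" for \<eta>
    proof -
      have "?G (SUP i. U i) \<eta> = (\<Sum>x\<in>patterns \<Lambda>. SUP i. ennreal (weight \<Lambda> x \<eta>) * U i (override_on \<eta> x \<Lambda>))"
        by (simp add: SUP_mult_left_ennreal image_comp)
      also have "\<dots> = (SUP i. ?G (U i) \<eta>)"
        using seq by (intro ennreal_SUP_sum[symmetric]) (auto simp: incseq_def le_fun_def intro!: mult_left_mono)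
      finally show ?thesis .
    qed
    have "incseq (\<lambda>i. ?G (U i))"
      using seq by (auto simp: incseq_def le_fun_def intro!: sum_mono mult_left_mono)
    then have "(\<integral>\<^sup>+\<eta>. (SUP i. ?G (U i) \<eta>) \<partial>\<mu>) = (SUP i. \<integral>\<^sup>+\<eta>. ?G (U i) \<eta> \<partial>\<mu>)"
      using seq by (intro nn_integral_monotone_convergence_SUP Gm)
    moreover have "(\<integral>\<^sup>+\<eta>. (SUP i. U i \<eta>) \<partial>\<mu>) = (SUP i. \<integral>\<^sup>+\<eta>. U i \<eta> \<partial>\<mu>)"
      using seq by (intro nn_integral_monotone_convergence_SUP m) auto
    ultimately show ?case
      using seq unfolding e by (simp add: image_comp)
  qed
qed

lemma integral_spec:
  assumes g: "gibbs \<Phi> \<mu>" and \<Lambda>: "finite \<Lambda>" and f: "f \<in> borel_measurable cfgM" "\<And>\<omega>. \<bar>f \<omega>\<bar> \<le> B"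
  shows "(\<integral>\<eta>. spec \<Phi> \<Lambda> f \<eta> \<partial>\<mu>) = (\<integral>\<eta>. f \<eta> \<partial>\<mu>)"
proof -
  interpret prob_space \<mu> using g by (simp add: gibbs_def)
  have S: "sets \<mu> = sets cfgM" using g by (simp add: gibbs_def)
  have m: "h \<in> borel_measurable cfgM \<Longrightarrow> h \<in> borel_measurable \<mu>" for h :: "'e config \<Rightarrow> real"
    using measurable_cong_sets[OF S refl] by blast
  \<comment> \<open>The shift makes the function nonnegative. The added constant is reproduced by
    \<open>spec\<close> and is removed at the end.\<close>
  let ?h = "\<lambda>\<omega>. f \<omega> + B"
  have h: "?h \<in> borel_measurable cfgM" "0 \<le> ?h \<omega>" "?h \<omega> \<le> 2 * B" for \<omega>
    using f(1) f(2)[of \<omega>] by (auto intro: borel_measurable_add)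
  have sm: "spec \<Phi> \<Lambda> ?h \<in> borel_measurable cfgM" by (rule spec_measurable[OF \<Lambda> h(1)])
  have s: "0 \<le> spec \<Phi> \<Lambda> ?h \<eta>" for \<eta>
    by (rule spec_between(1)[OF \<Lambda>, of _ _ _ "2 * B"]) (use h in auto)
  have "(\<integral>\<eta>. spec \<Phi> \<Lambda> ?h \<eta> \<partial>\<mu>) = enn2real (\<integral>\<^sup>+\<eta>. ennreal (spec \<Phi> \<Lambda> ?h \<eta>) \<partial>\<mu>)"
    by (rule integral_eq_nn_integral[OF m[OF sm]]) (simp add: s)
  also have "(\<integral>\<^sup>+\<eta>. ennreal (spec \<Phi> \<Lambda> ?h \<eta>) \<partial>\<mu>) = (\<integral>\<^sup>+\<eta>. ennreal (?h \<eta>) \<partial>\<mu>)"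
  proof -
    have "ennreal (spec \<Phi> \<Lambda> ?h \<eta>)
        = (\<Sum>x\<in>patterns \<Lambda>. ennreal (weight \<Lambda> x \<eta>) * ennreal (?h (override_on \<eta> x \<Lambda>)))" for \<eta>
      unfolding spec_eq_sum
      by (subst sum_ennreal[symmetric]) (auto simp: weight_nonneg h(2) ennreal_mult simp del: sum_ennreal)
    then show ?thesis
      using nn_integral_spec[OF g \<Lambda>, of "\<lambda>\<omega>. ennreal (?h \<omega>)"] h(1) by simp
  qed
  also have "enn2real \<dots> = (\<integral>\<eta>. ?h \<eta> \<partial>\<mu>)"
    by (rule integral_eq_nn_integral[OF m[OF h(1)], symmetric]) (simp add: h(2))
  finally have *: "(\<integral>\<eta>. spec \<Phi> \<Lambda> ?h \<eta> \<partial>\<mu>) = (\<integral>\<eta>. ?h \<eta> \<partial>\<mu>)" .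
  have "integrable \<mu> f" by (rule integrable_const_bound[of _ B]) (simp_all add: f m)
  moreover have "integrable \<mu> (spec \<Phi> \<Lambda> f)"
    by (rule integrable_const_bound[of _ B])
      (simp_all add: spec_abs_le[OF \<Lambda> f(2)] m spec_measurable[OF \<Lambda> f(1)])
  moreover have "spec \<Phi> \<Lambda> ?h \<eta> = spec \<Phi> \<Lambda> f \<eta> + B" for \<eta>
    by (simp add: spec_add spec_const[OF \<Lambda>])
  ultimately show ?thesis using * by simp
qed

end

context dobrushin_interaction
begin

lemma sweep_bounded: "(\<And>\<omega>. \<bar>f \<omega>\<bar> \<le> B) \<Longrightarrow> \<bar>sweep is f \<omega>\<bar> \<le> B"
  by (induction "is" arbitrary: \<omega>) (auto intro: spec_abs_le)

lemma sweep_measurable: "f \<in> borel_measurable cfgM \<Longrightarrow> sweep is f \<in> borel_measurable cfgM"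
  by (induction "is") (auto intro: spec_measurable)

lemma integral_sweep:
  assumes "gibbs \<Phi> \<mu>" "f \<in> borel_measurable cfgM" "\<And>\<omega>. \<bar>f \<omega>\<bar> \<le> B"
  shows "(\<integral>\<eta>. sweep is f \<eta> \<partial>\<mu>) = (\<integral>\<eta>. f \<eta> \<partial>\<mu>)"
proof (induction "is")
  case (Cons i "is")
  then show ?case
    using integral_spec[OF assms(1) _ sweep_measurable[OF assms(2)] sweep_bounded[OF assms(3)], of "{i}" "is"]
    by simp
qed simp

text \<open>Every Gibbs measure leaves integrals unchanged under sweeps, and a long sweep of a local
  function is almost constant. Both integrals are thus close to one common number. Indicators of
  cylinders are local, and cylinders determine the measure.\<close>

lemma gibbs_unique:
  assumes "gibbs \<Phi> \<mu>" "gibbs \<Phi> \<nu>" shows "\<mu> = \<nu>"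
proof -
  interpret \<mu>: prob_space \<mu> using assms by (simp add: gibbs_def)
  interpret \<nu>: prob_space \<nu> using assms by (simp add: gibbs_def)
  have S: "sets \<mu> = sets cfgM" "sets \<nu> = sets cfgM" using assms by (simp_all add: gibbs_def)
  have m: "h \<in> borel_measurable \<mu>" "h \<in> borel_measurable \<nu>"
    if "h \<in> borel_measurable cfgM" for h :: "'a config \<Rightarrow> real"
    using that measurable_cong_sets[OF S(1) refl] measurable_cong_sets[OF S(2) refl] by blast+
  have eq: "(\<integral>\<eta>. f \<eta> \<partial>\<mu>) = (\<integral>\<eta>. f \<eta> \<partial>\<nu>)" if J: "finite J" "depends_on J f" for J and f :: "'a config \<Rightarrow> real"
  proof -
    obtain B where B: "\<And>\<omega>. \<bar>f \<omega>\<bar> \<le> B" using depends_on_bounded[OF J] by blast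
    obtain v where v: "osc_bound v f" using depends_on_osc_bound[OF J] by blast
    have fm: "f \<in> borel_measurable cfgM" using J by (rule depends_on_measurable)
    \<comment> \<open>The summand 0 matches the shape required by
      \<open>field_le_epsilon\<close>.\<close>
    have "\<bar>(\<integral>\<eta>. f \<eta> \<partial>\<mu>) - (\<integral>\<eta>. f \<eta> \<partial>\<nu>)\<bar> \<le> 0 + e" if "e > 0" for e
    proof -
      obtain "is" where "is": "\<And>\<xi> \<eta>. \<bar>sweep is f \<xi> - sweep is f \<eta>\<bar> \<le> e / 2"
        using sweep_almost_constant[OF v] \<open>e > 0\<close> by (metis half_gt_zero)
      have sm: "sweep is f \<in> borel_measurable cfgM" by (rule sweep_measurable[OF fm])
      have "\<bar>(\<integral>\<eta>. sweep is f \<eta> \<partial>\<mu>) - sweep is f undefined\<bar> \<le> e / 2"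
        by (rule \<mu>.abs_integral_diff_le[OF m(1)[OF sm]]) (rule "is")
      moreover have "\<bar>(\<integral>\<eta>. sweep is f \<eta> \<partial>\<nu>) - sweep is f undefined\<bar> \<le> e / 2"
        by (rule \<nu>.abs_integral_diff_le[OF m(2)[OF sm]]) (rule "is")
      ultimately show ?thesis
        unfolding integral_sweep[OF assms(1) fm B] integral_sweep[OF assms(2) fm B] by linarith
    qed
    then have "\<bar>(\<integral>\<eta>. f \<eta> \<partial>\<mu>) - (\<integral>\<eta>. f \<eta> \<partial>\<nu>)\<bar> \<le> 0" by (rule field_le_epsilon)
    then show ?thesis by simp
  qed
  show ?thesis
  proof (rule measure_eqI_PiM_infinite)
    show "sets \<mu> = sets (PiM UNIV (\<lambda>_. count_space UNIV))" "sets \<nu> = sets (PiM UNIV (\<lambda>_. count_space UNIV))"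
      using S by (simp_all add: cfgM_def)
    show "finite_measure \<mu>" by unfold_locales
    fix A :: "int \<Rightarrow> 'a set" and J :: "int set" assume J: "finite J"
    let ?S = "prod_emb UNIV (\<lambda>_. count_space UNIV) J (PiE J A)"
    have SS: "?S = {\<omega>. \<forall>i\<in>J. \<omega> i \<in> A i}" by (auto simp: prod_emb_def)
    have d: "depends_on J (indicator ?S :: _ \<Rightarrow> real)"
      by (rule depends_on_indicator) (simp add: SS)
    have "?S \<in> sets cfgM"
      unfolding cfgM_def using J by (intro sets_PiM_I) auto
    then show "emeasure \<mu> ?S = emeasure \<nu> ?S"
      using eq[OF J d] S by (simp add: \<mu>.emeasure_eq_measure \<nu>.emeasure_eq_measure)
  qed
qed

end

section \<open>Existence of the Gibbs measure\<close>

text \<open>The projective limit is formed for Borel measures on a Polish space, so letters are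
  encoded as reals, the limit is taken on real sequences indexed by the integers, and the result is
  decoded coordinate by coordinate.\<close>

lemma kolmogorov_extension_cyl:
  fixes p :: "int set \<Rightarrow> ('e::finite) config \<Rightarrow> real"
  assumes nonneg: "\<And>J x. finite J \<Longrightarrow> 0 \<le> p J x"
    and total: "\<And>J. finite J \<Longrightarrow> (\<Sum>x\<in>patterns J. p J x) = 1"
    and consistent: "\<And>J H x. finite H \<Longrightarrow> J \<subseteq> H \<Longrightarrow> x \<in> patterns J \<Longrightarrow>
        p J x = (\<Sum>y\<in>{y\<in>patterns H. restrict y J = x}. p H y)"
  obtains \<mu> where "prob_space \<mu>" "sets \<mu> = sets cfgM"
    "\<And>J x. finite J \<Longrightarrow> x \<in> patterns J \<Longrightarrow> measure \<mu> (cyl J x) = p J x"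
proof -
  \<comment> \<open>The law on \<open>J\<close> is placed on full configurations but charges only
    extensional patterns, so laws for different \<open>J\<close> share one type and restriction is
    an ordinary image.\<close>
  define Q where "Q J = embed_pmf (\<lambda>x. if x \<in> patterns J then p J x else 0)" for J
  have pmf_Q: "pmf (Q J) x = (if x \<in> patterns J then p J x else 0)" if J: "finite J" for J x
    unfolding Q_def
  proof (rule pmf_embed_pmf)
    show "0 \<le> (if x \<in> patterns J then p J x else 0)" for x using nonneg[OF J] by simp
    have "(\<integral>\<^sup>+x. ennreal (if x \<in> patterns J then p J x else 0) \<partial>count_space UNIV)
        = (\<Sum>x\<in>patterns J. ennreal (p J x))"
      by (subst nn_integral_count_space'[OF finite_patterns[OF J]]) auto
    also have "\<dots> = ennreal (\<Sum>x\<in>patterns J. p J x)"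
      using nonneg[OF J] by simp
    finally show "(\<integral>\<^sup>+x. ennreal (if x \<in> patterns J then p J x else 0) \<partial>count_space UNIV) = 1"
      by (simp add: total[OF J])
  qed
  have measure_Q: "measure (Q H) S = (\<Sum>y\<in>{y\<in>patterns H. y \<in> S}. p H y)" if H: "finite H" for H S
  proof -
    have sub: "set_pmf (Q H) \<subseteq> patterns H"
      by (auto simp: set_pmf_iff pmf_Q[OF H] split: if_splits)
    then have "S \<inter> set_pmf (Q H) = (S \<inter> patterns H) \<inter> set_pmf (Q H)" by blast
    then have "measure (Q H) S = measure (Q H) (S \<inter> patterns H)"
      by (metis measure_Int_set_pmf)
    also have "\<dots> = sum (pmf (Q H)) (S \<inter> patterns H)"
      using finite_patterns[OF H] by (intro measure_measure_pmf_finite) blast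
    also have "\<dots> = (\<Sum>y\<in>{y\<in>patterns H. y \<in> S}. p H y)"
      by (intro sum.cong) (auto simp: pmf_Q[OF H])
    finally show ?thesis .
  qed
  have Q_restrict: "Q J = map_pmf (\<lambda>x. restrict x J) (Q H)" if H: "finite H" "J \<subseteq> H" for J H
  proof (rule pmf_eqI)
    fix x
    have J: "finite J" using H by (blast intro: finite_subset)
    show "pmf (Q J) x = pmf (map_pmf (\<lambda>x. restrict x J) (Q H)) x"
    proof (cases "x \<in> patterns J")
      case True
      then show ?thesis
        by (simp add: pmf_Q[OF J] pmf_map measure_Q[OF H(1)] consistent[OF H])
    next
      case False
      then have no: "restrict y J \<noteq> x" for y by auto
      have "measure (Q H) ((\<lambda>x. restrict x J) -` {x}) = 0"
        unfolding measure_Q[OF H(1)] by (rule sum.neutral) (use no in auto)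
      then show ?thesis using False by (simp add: pmf_Q[OF J] pmf_map)
    qed
  qed
  \<comment> \<open>\<open>decode\<close> is defined on every real through the floor, which makes it
    measurable on the whole line; only its values on the range of \<open>code\<close> carry
    information.\<close>
  define code where "code a = real (to_nat (a :: 'e))" for a
  define decode where "decode r = (from_nat (nat \<lfloor>r :: real\<rfloor>) :: 'e)" for r
  have decode_code: "decode (code a) = a" for a by (simp add: code_def decode_def)
  have decode_meas: "decode \<in> borel \<rightarrow>\<^sub>M count_space UNIV"
    unfolding decode_def
    by (rule measurable_compose[OF measurable_real_floor]) simp
  have decode_comp: "(\<lambda>\<omega>. decode (\<omega> i)) \<in> PiM I (\<lambda>_. borel) \<rightarrow>\<^sub>M count_space UNIV"
    if "i \<in> I" for i and I :: "int set"
    using that by (intro measurable_compose[OF _ decode_meas] measurable_component_singleton)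
  define enc where "enc J x = (\<lambda>i\<in>J. code (x i))" for J :: "int set" and x :: "'e config"
  define P where "P J = distr (measure_pmf (Q J)) (PiM J (\<lambda>_. borel)) (enc J)" for J
  have enc_meas: "enc J \<in> count_space UNIV \<rightarrow>\<^sub>M PiM J (\<lambda>_. borel)" for J
    by (auto simp: enc_def space_PiM)
  have enc_meas': "enc J \<in> measure_pmf q \<rightarrow>\<^sub>M PiM J (\<lambda>_. borel)" for J q
    using enc_meas by (simp cong: measurable_cong_sets)
  have res_meas: "(\<lambda>f. restrict f J) \<in> PiM H (\<lambda>_. borel) \<rightarrow>\<^sub>M PiM J (\<lambda>_. borel :: real measure)"
    if "J \<subseteq> H" for J H :: "int set" using that by (rule measurable_restrict_subset)
  interpret L: polish_projective UNIV P
  proof (intro polish_projective.intro projective_family.intro)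
    fix J H :: "int set" assume JH: "J \<subseteq> H" "finite H" "H \<subseteq> UNIV"
    have e1: "restrict (enc H x) J = enc J (restrict x J)" for x
      using JH by (auto simp: enc_def restrict_def fun_eq_iff)
    have "distr (P H) (PiM J (\<lambda>_. borel)) (\<lambda>f. restrict f J)
        = distr (measure_pmf (Q H)) (PiM J (\<lambda>_. borel)) ((\<lambda>f. restrict f J) \<circ> enc H)"
      unfolding P_def by (rule distr_distr[OF res_meas[OF JH(1)] enc_meas'])
    also have "(\<lambda>f. restrict f J) \<circ> enc H = enc J \<circ> (\<lambda>x. restrict x J)"
      using e1 by auto
    also have "distr (measure_pmf (Q H)) (PiM J (\<lambda>_. borel)) \<dots>
        = distr (distr (measure_pmf (Q H)) (count_space UNIV) (\<lambda>x. restrict x J)) (PiM J (\<lambda>_. borel)) (enc J)"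
      by (rule distr_distr[symmetric, OF enc_meas]) simp
    also have "distr (measure_pmf (Q H)) (count_space UNIV) (\<lambda>x. restrict x J) = measure_pmf (Q J)"
      unfolding Q_restrict[OF JH(2,1)] by (simp add: map_pmf_rep_eq)
    finally show "P J = distr (P H) (PiM J (\<lambda>_. borel)) (\<lambda>f. restrict f J)"
      unfolding P_def[of J] by (rule sym)
  next
    show "prob_space (P J)" for J
      unfolding P_def by (rule measure_pmf.prob_space_distr[OF enc_meas'])
  qed
  define D where "D \<omega> = (\<lambda>i. decode (\<omega> i))" for \<omega> :: "int \<Rightarrow> real"
  have D_meas: "D \<in> L.lim \<rightarrow>\<^sub>M cfgM"
  proof -
    have "(\<lambda>\<omega>. D \<omega> i) \<in> PiM UNIV (\<lambda>_. borel) \<rightarrow>\<^sub>M count_space UNIV" for i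
      unfolding D_def by (rule decode_comp) simp
    then have "D \<in> PiM UNIV (\<lambda>_. borel) \<rightarrow>\<^sub>M cfgM"
      unfolding cfgM_def by (intro measurable_PiM_single') auto
    then show ?thesis by (simp cong: measurable_cong_sets)
  qed
  show ?thesis
  proof (rule that[of "distr L.lim cfgM D"])
    show "prob_space (distr L.lim cfgM D)" by (rule L.P.prob_space_distr[OF D_meas])
    fix J :: "int set" and x :: "'e config" assume J: "finite J" and x: "x \<in> patterns J"
    \<comment> \<open>All real vectors that decode to \<open>x\<close>, not just the code of
      \<open>x\<close>, because the preimage of the cylinder under \<open>D\<close> contains them
      all.\<close>
    define X where "X = {f \<in> space (PiM J (\<lambda>_. borel)). \<forall>i\<in>J. decode (f i) \<in> {x i}}"
    have X: "X \<in> sets (PiM J (\<lambda>_. borel))"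
      unfolding X_def using J
      by (intro sets.sets_Collect_finite_All measurable_sets_Collect[OF decode_comp]) auto
    have "D -` cyl J x \<inter> space L.lim = prod_emb UNIV (\<lambda>_. borel) J X"
      by (auto simp: prod_emb_def X_def cyl_def D_def space_PiM)
    then have "measure (distr L.lim cfgM D) (cyl J x) = measure L.lim (prod_emb UNIV (\<lambda>_. borel) J X)"
      using measure_distr[OF D_meas sets_cyl[OF J]] by simp
    also have "\<dots> = measure (P J) X"
      by (rule L.measure_lim_emb[OF _ J X]) simp
    also have "\<dots> = measure (Q J) (enc J -` X)"
      unfolding P_def using measure_distr[OF enc_meas' X] by simp
    also have "\<dots> = (\<Sum>y\<in>{y\<in>patterns J. y \<in> enc J -` X}. p J y)" by (rule measure_Q[OF J])
    also have "{y\<in>patterns J. y \<in> enc J -` X} = {x}"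
    proof (intro equalityI subsetI)
      fix y assume "y \<in> {y\<in>patterns J. y \<in> enc J -` X}"
      then have "y \<in> patterns J" "\<forall>i\<in>J. y i = x i" by (auto simp: X_def enc_def decode_code)
      then show "y \<in> {x}" using x by (auto intro: PiE_ext)
    qed (use x in \<open>auto simp: X_def enc_def decode_code space_PiM\<close>)
    finally show "measure (distr L.lim cfgM D) (cyl J x) = p J x" by simp
  qed simp
qed

lemma depends_on_cyl: "J \<subseteq> H \<Longrightarrow> depends_on H (indicator (cyl J x) :: _ \<Rightarrow> real)"
  by (rule depends_on_indicator) (auto simp: cyl_def subset_eq)

lemma abs_indicator_le: "\<bar>indicator A x :: real\<bar> \<le> 1"
  by (simp split: split_indicator)

lemma integral_depends_on:
  fixes f :: "('e::finite) config \<Rightarrow> real"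
  assumes "prob_space \<mu>" "sets \<mu> = sets cfgM" "finite J" "depends_on J f"
  shows "(\<integral>\<omega>. f \<omega> \<partial>\<mu>) = (\<Sum>x\<in>patterns J. f x * measure \<mu> (cyl J x))"
proof -
  interpret prob_space \<mu> by fact
  have "(\<integral>\<omega>. f \<omega> \<partial>\<mu>) = (\<integral>\<omega>. (\<Sum>x\<in>patterns J. f x * indicator (cyl J x) \<omega>) \<partial>\<mu>)"
    using depends_on_eq_sum[OF assms(3,4)] by (intro Bochner_Integration.integral_cong refl)
  also have "\<dots> = (\<Sum>x\<in>patterns J. \<integral>\<omega>. f x * indicator (cyl J x) \<omega> \<partial>\<mu>)"
    using sets_cyl[OF assms(3)] assms(2)
    by (intro Bochner_Integration.integral_sum integrable_mult_right integrable_real_indicator)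
      (auto simp: emeasure_eq_measure)
  also have "\<dots> = (\<Sum>x\<in>patterns J. f x * measure \<mu> (cyl J x))"
    using sets_eq_imp_space_eq[OF assms(2)] by (simp add: space_cfgM)
  finally show ?thesis .
qed

context uac_interaction
begin

text \<open>Indicators of the generating cylinders are local. The events satisfying the Gibbs
  equation are closed under complements and countable disjoint unions, and the generator is stable
  under intersection, so the Dynkin argument reaches every event.\<close>

lemma gibbsI_cylinder:
  assumes \<mu>: "prob_space \<mu>" "sets \<mu> = sets cfgM"
    and local: "\<And>\<Lambda> J f. finite \<Lambda> \<Longrightarrow> finite J \<Longrightarrow> depends_on J f \<Longrightarrow>
      (\<integral>\<eta>. spec \<Phi> \<Lambda> f \<eta> \<partial>\<mu>) = (\<integral>\<eta>. f \<eta> \<partial>\<mu>)"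
  shows "gibbs \<Phi> \<mu>"
  unfolding gibbs_def gibbs_kernel_eq_spec
proof (intro conjI \<mu> allI impI ballI)
  interpret prob_space \<mu> by fact
  fix \<Lambda> :: "int set" and A :: "'e config set" assume \<Lambda>: "finite \<Lambda>" and A: "A \<in> sets cfgM"
  let ?M = "\<lambda>_::int. count_space (UNIV :: 'e set)"
  let ?G = "prod_algebra UNIV ?M"
  have sp: "space \<mu> = UNIV" using sets_eq_imp_space_eq[OF \<mu>(2)] by (simp add: space_cfgM)
  have UN: "(\<Pi>\<^sub>E i\<in>UNIV. space (?M i)) = UNIV" by (auto simp: PiE_UNIV_domain)
  have sets_eq: "sets \<mu> = sigma_sets UNIV ?G"
    unfolding \<mu>(2) cfgM_def sets_PiM UN ..
  have m: "h \<in> borel_measurable cfgM \<Longrightarrow> h \<in> borel_measurable \<mu>" for h :: "'e config \<Rightarrow> real"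
    using measurable_cong_sets[OF \<mu>(2) refl] by blast
  have sm: "spec \<Phi> \<Lambda> (indicator S) \<in> borel_measurable \<mu>" if "S \<in> sets \<mu>" for S
    using that \<mu>(2) by (intro m spec_measurable[OF \<Lambda>] borel_measurable_indicator) simp
  have sb: "\<bar>spec \<Phi> \<Lambda> (indicator S) \<eta>\<bar> \<le> 1" for S \<eta>
    by (rule spec_abs_le[OF \<Lambda> abs_indicator_le])
  have si: "integrable \<mu> (spec \<Phi> \<Lambda> (indicator S))" if "S \<in> sets \<mu>" for S
    by (rule integrable_const_bound[of _ 1, OF _ sm[OF that]]) (simp add: sb)
  have "Int_stable ?G" by (rule Int_stable_prod_algebra)
  moreover have "?G \<subseteq> Pow UNIV" by simp
  moreover have "A \<in> sigma_sets UNIV ?G" using A \<mu>(2) sets_eq by simp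
  ultimately show "measure \<mu> A = (\<integral>\<eta>. spec \<Phi> \<Lambda> (indicator A) \<eta> \<partial>\<mu>)"
  proof (induction rule: sigma_sets_induct_disjoint)
    case (basic B)
    then have "B \<in> sets \<mu>" by (simp add: sets_eq)
    from basic obtain J E where J: "B = prod_emb UNIV ?M J (\<Pi>\<^sub>E j\<in>J. E j)" "finite J"
      by (elim prod_algebraE)
    then have BB: "B = {\<omega>. \<forall>i\<in>J. \<omega> i \<in> E i}" by (auto simp: prod_emb_def)
    have "depends_on J (indicator B :: _ \<Rightarrow> real)"
      by (rule depends_on_indicator) (simp add: BB)
    from local[OF \<Lambda> J(2) this] \<open>B \<in> sets \<mu>\<close> show ?case by simp
  next
    case empty
    have "spec \<Phi> \<Lambda> (indicator {}) \<eta> = 0" for \<eta>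
      using spec_const[OF \<Lambda>, of \<Phi> 0 \<eta>] by (simp add: indicator_def[abs_def])
    then show ?case by (subst Bochner_Integration.integral_cong[OF refl]) auto
  next
    case (compl B)
    then have B: "B \<in> sets \<mu>" by (simp add: sets_eq)
    have ind: "indicator (UNIV - B) = (\<lambda>\<omega>. 1 - indicator B \<omega> :: real)"
      by (auto split: split_indicator)
    have "spec \<Phi> \<Lambda> (indicator (UNIV - B)) \<eta> = 1 - spec \<Phi> \<Lambda> (indicator B) \<eta>" for \<eta>
      unfolding ind spec_diff spec_const[OF \<Lambda>] ..
    then show ?case
      using compl.IH prob_compl[OF B] si[OF B] prob_space by (simp add: sp)
  next
    case (union B)
    have Bs: "B i \<in> sets \<mu>" for i using union by (auto simp: sets_eq)
    have part: "(\<Sum>i<n. spec \<Phi> \<Lambda> (indicator (B i)) \<eta>) = spec \<Phi> \<Lambda> (\<lambda>\<omega>. \<Sum>i<n. indicator (B i) \<omega>) \<eta>" for n \<eta>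
      by (simp add: spec_sum)
    have ind: "(\<lambda>i. indicator (B i) \<omega> :: real) sums indicator (\<Union>i. B i) \<omega>" for \<omega>
      using union by (intro indicator_sums) (auto simp: disjoint_family_on_def)
    have lim: "(\<lambda>n. \<Sum>i<n. spec \<Phi> \<Lambda> (indicator (B i)) \<eta>) \<longlonglongrightarrow> spec \<Phi> \<Lambda> (indicator (\<Union>i. B i)) \<eta>" for \<eta>
      unfolding part unfolding spec_eq_sum by (intro tendsto_intros ind[unfolded sums_def])
    \<comment> \<open>Disjointness keeps each partial sum of indicators below the indicator of the
      union. This provides the dominating constant 1.\<close>
    have bound: "\<bar>\<Sum>i<n. spec \<Phi> \<Lambda> (indicator (B i)) \<eta>\<bar> \<le> 1" for n \<eta>
      unfolding part
    proof (rule spec_abs_le[OF \<Lambda>])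
      fix \<omega>
      have "(\<Sum>i<n. indicator (B i) \<omega> :: real) \<le> indicator (\<Union>i. B i) \<omega>"
        unfolding sums_unique[OF ind] by (rule sum_le_suminf[OF sums_summable[OF ind]]) auto
      also have "\<dots> \<le> 1" by (simp split: split_indicator)
      finally show "\<bar>\<Sum>i<n. indicator (B i) \<omega> :: real\<bar> \<le> 1" by (simp add: sum_nonneg)
    qed
    have "(\<lambda>n. \<integral>\<eta>. (\<Sum>i<n. spec \<Phi> \<Lambda> (indicator (B i)) \<eta>) \<partial>\<mu>)
        \<longlonglongrightarrow> (\<integral>\<eta>. spec \<Phi> \<Lambda> (indicator (\<Union>i. B i)) \<eta> \<partial>\<mu>)"
    proof (rule integral_dominated_convergence[where w = "\<lambda>_. 1"])
      show "spec \<Phi> \<Lambda> (indicator (\<Union>i. B i)) \<in> borel_measurable \<mu>"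
        using Bs by (intro sm) auto
      show "(\<lambda>\<eta>. \<Sum>i<n. spec \<Phi> \<Lambda> (indicator (B i)) \<eta>) \<in> borel_measurable \<mu>" for n
        using Bs by (intro borel_measurable_sum sm)
    qed (use lim bound in auto)
    moreover have "(\<integral>\<eta>. (\<Sum>i<n. spec \<Phi> \<Lambda> (indicator (B i)) \<eta>) \<partial>\<mu>) = (\<Sum>i<n. measure \<mu> (B i))" for n
      using Bs union by (simp add: Bochner_Integration.integral_sum si)
    moreover have "(\<lambda>n. \<Sum>i<n. measure \<mu> (B i)) \<longlonglongrightarrow> measure \<mu> (\<Union>i. B i)"
      using finite_measure_UNION[of B] Bs union by (auto simp: sums_def)
    ultimately show ?case by (simp add: LIMSEQ_unique)
  qed
qed

end

section \<open>Thermodynamic limit along symmetric windows\<close>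

definition window :: "nat \<Rightarrow> int set" where "window n = {- int n..int n}"

lemma finite_window: "finite (window n)" by (simp add: window_def)

lemma eventually_subset_window:
  assumes "finite J" shows "eventually (\<lambda>n. J \<subseteq> window n) sequentially"
proof -
  obtain N :: int where N: "\<And>i. i \<in> J \<Longrightarrow> \<bar>i\<bar> \<le> N"
    using finite_imageI[OF assms, of abs] by (metis Max_ge imageI)
  show ?thesis
  proof (rule eventually_sequentiallyI)
    fix n assume "nat N \<le> n"
    then show "J \<subseteq> window n" using N by (fastforce simp: window_def)
  qed
qed

context dobrushin_interaction
begin

text \<open>Infinite-volume expectation, with the arbitrary but fixed configuration
  \<open>undefined\<close> as boundary condition.\<close>

definition state :: "('a config \<Rightarrow> real) \<Rightarrow> real" where
  "state f = lim (\<lambda>n. spec \<Phi> (window n) f undefined)"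

text \<open>Once a window contains all sites of a sweep, the average of \<open>f\<close> equals that
  of the swept function, which is within \<open>e / 3\<close> of its value at one configuration. All
  later averages are therefore close to the same number.\<close>

lemma state_LIMSEQ:
  assumes J: "finite J" "depends_on J f"
  shows "(\<lambda>n. spec \<Phi> (window n) f undefined) \<longlonglongrightarrow> state f"
proof -
  obtain v where v: "osc_bound v f" using depends_on_osc_bound[OF J] by blast
  have "Cauchy (\<lambda>n. spec \<Phi> (window n) f undefined)"
  proof (rule metric_CauchyI)
    fix e :: real assume "e > 0"
    then obtain "is" where "is": "\<And>\<xi> \<eta>. \<bar>sweep is f \<xi> - sweep is f \<eta>\<bar> \<le> e / 3"
      using sweep_almost_constant[OF v, of "e / 3"] by auto
    obtain N where N: "\<And>n. N \<le> n \<Longrightarrow> set is \<subseteq> window n"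
      using eventually_subset_window[of "set is"] by (auto simp: eventually_sequentially)
    have close: "\<bar>spec \<Phi> (window n) f undefined - sweep is f undefined\<bar> \<le> e / 3" if "N \<le> n" for n
    proof -
      have "\<bar>spec \<Phi> (window n) (sweep is f) undefined - sweep is f undefined\<bar> \<le> e / 3"
        by (rule spec_abs_diff_le[OF finite_window]) (rule "is")
      then show ?thesis unfolding spec_sweep[OF N[OF that] finite_window] .
    qed
    show "\<exists>N. \<forall>m\<ge>N. \<forall>n\<ge>N. dist (spec \<Phi> (window m) f undefined) (spec \<Phi> (window n) f undefined) < e"
    proof (intro exI allI impI)
      fix m n assume "N \<le> m" "N \<le> n"
      from close[OF this(1)] close[OF this(2)] \<open>e > 0\<close>
      show "dist (spec \<Phi> (window m) f undefined) (spec \<Phi> (window n) f undefined) < e"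
        unfolding dist_real_def by linarith
    qed
  qed
  then show ?thesis unfolding state_def by (simp add: Cauchy_convergent_iff convergent_LIMSEQ_iff)
qed

lemma state_sum_cyl:
  assumes J: "finite J" "depends_on J f"
  shows "state f = (\<Sum>x\<in>patterns J. f x * state (indicator (cyl J x)))"
proof (rule LIMSEQ_unique[OF state_LIMSEQ[OF J]])
  have "spec \<Phi> (window n) f undefined
      = (\<Sum>x\<in>patterns J. f x * spec \<Phi> (window n) (indicator (cyl J x)) undefined)" for n
  proof -
    have "spec \<Phi> (window n) f undefined
        = spec \<Phi> (window n) (\<lambda>\<omega>. \<Sum>x\<in>patterns J. f x * indicator (cyl J x) \<omega>) undefined"
      by (rule spec_cong) (rule depends_on_eq_sum[OF J])
    then show ?thesis unfolding spec_sum spec_cmult .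
  qed
  moreover have "(\<lambda>n. \<Sum>x\<in>patterns J. f x * spec \<Phi> (window n) (indicator (cyl J x)) undefined)
      \<longlonglongrightarrow> (\<Sum>x\<in>patterns J. f x * state (indicator (cyl J x)))"
    by (intro tendsto_intros state_LIMSEQ[OF J(1)] depends_on_cyl) simp
  ultimately show "(\<lambda>n. spec \<Phi> (window n) f undefined)
      \<longlonglongrightarrow> (\<Sum>x\<in>patterns J. f x * state (indicator (cyl J x)))" by simp
qed

text \<open>Limits of cylinder probabilities are consistent because each finite-volume average is
  linear. The extended measure satisfies the Gibbs equation since, for large windows, averaging over
  \<Lambda> first changes nothing.\<close>

lemma gibbs_exists: "\<exists>\<mu>. gibbs \<Phi> \<mu>"
proof -
  define p where "p J x = state (indicator (cyl J x))" for J x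
  have nonneg: "0 \<le> p J x" if "finite J" for J x
    unfolding p_def
  proof (rule LIMSEQ_le_const[OF state_LIMSEQ[OF that depends_on_cyl]])
    show "\<exists>N. \<forall>n\<ge>N. 0 \<le> spec \<Phi> (window n) (indicator (cyl J x)) undefined"
      by (intro exI allI impI spec_between(1)[OF finite_window, where b = 1]) (auto split: split_indicator)
  qed simp
  have total: "(\<Sum>x\<in>patterns J. p J x) = 1" if "finite J" for J
  proof -
    have "(\<lambda>n. spec \<Phi> (window n) (\<lambda>_. 1) undefined) \<longlonglongrightarrow> state (\<lambda>_. 1)"
      by (rule state_LIMSEQ[OF that]) (simp add: depends_on_def)
    then have "state (\<lambda>_. 1) = 1" by (simp add: spec_const[OF finite_window] LIMSEQ_const_iff)
    then show ?thesis
      using state_sum_cyl[OF that, of "\<lambda>_. 1"] by (simp add: depends_on_def p_def)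
  qed
  have consistent: "p J x = (\<Sum>y\<in>{y\<in>patterns H. restrict y J = x}. p H y)"
    if "finite H" "J \<subseteq> H" "x \<in> patterns J" for J H x
  proof -
    have "p J x = (\<Sum>y\<in>patterns H. indicator (cyl J x) y * p H y)"
      unfolding p_def by (rule state_sum_cyl[OF that(1) depends_on_cyl[OF that(2)]])
    also have "\<dots> = (\<Sum>y\<in>{y\<in>patterns H. y \<in> cyl J x}. p H y)"
      by (rule sum.mono_neutral_cong_right[OF finite_patterns[OF that(1)]]) auto
    also have "{y\<in>patterns H. y \<in> cyl J x} = {y\<in>patterns H. restrict y J = x}"
    proof -
      have "y \<in> cyl J x \<longleftrightarrow> restrict y J = x" for y
      proof
        assume "y \<in> cyl J x"
        then show "restrict y J = x"
          using that(3) by (intro PiE_ext[of _ J "\<lambda>_. UNIV"]) (auto simp: cyl_def)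
      next
        assume "restrict y J = x"
        then show "y \<in> cyl J x" by (auto simp: cyl_def)
      qed
      then show ?thesis by simp
    qed
    finally show ?thesis .
  qed
  obtain \<mu> where \<mu>: "prob_space \<mu>" "sets \<mu> = sets cfgM"
    and cyl: "\<And>J x. finite J \<Longrightarrow> x \<in> patterns J \<Longrightarrow> measure \<mu> (cyl J x) = p J x"
    using kolmogorov_extension_cyl[of p, OF nonneg total consistent] by blast
  interpret prob_space \<mu> by fact
  have m: "h \<in> borel_measurable cfgM \<Longrightarrow> h \<in> borel_measurable \<mu>" for h :: "'a config \<Rightarrow> real"
    using measurable_cong_sets[OF \<mu>(2) refl] by blast
  have local: "(\<integral>\<omega>. f \<omega> \<partial>\<mu>) = state f" if J: "finite J" "depends_on J f" for J f
    unfolding integral_depends_on[OF \<mu> J] state_sum_cyl[OF J]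
    by (intro sum.cong refl) (simp add: cyl[OF J(1)] p_def)
  \<comment> \<open>Convergence is needed beyond local functions:
    \<open>spec \<Phi> \<Lambda> f\<close> is in general only quasilocal. A uniform approximation
    costs \<open>e / 3\<close> on each side, independently of the window.\<close>
  have lim: "(\<lambda>n. spec \<Phi> (window n) g undefined) \<longlonglongrightarrow> (\<integral>\<omega>. g \<omega> \<partial>\<mu>)"
    if g: "quasilocal g" "\<And>\<omega>. \<bar>g \<omega>\<bar> \<le> B" for g B
  proof (rule LIMSEQ_I)
    fix e :: real assume "e > 0"
    then obtain J h where h: "finite J" "depends_on J h" "\<And>\<omega>. \<bar>g \<omega> - h \<omega>\<bar> \<le> e / 3"
      using quasilocal_approx[OF g(1), of "e / 3"] by auto
    obtain B' where B': "\<And>\<omega>. \<bar>h \<omega>\<bar> \<le> B'" using depends_on_bounded[OF h(1,2)] by blast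
    have gm: "g \<in> borel_measurable \<mu>" by (rule m[OF quasilocal_measurable[OF g(1)]])
    have hm: "h \<in> borel_measurable \<mu>" by (rule m[OF depends_on_measurable[OF h(1,2)]])
    have gi: "integrable \<mu> g" by (rule integrable_const_bound[of _ B, OF _ gm]) (simp add: g(2))
    have hi: "integrable \<mu> h" by (rule integrable_const_bound[of _ B', OF _ hm]) (simp add: B')
    have "\<bar>(\<integral>\<omega>. g \<omega> - h \<omega> \<partial>\<mu>) - 0\<bar> \<le> e / 3"
      by (rule abs_integral_diff_le) (use h(3) gm hm in auto)
    then have 1: "\<bar>(\<integral>\<omega>. g \<omega> \<partial>\<mu>) - state h\<bar> \<le> e / 3"
      using gi hi local[OF h(1,2)] by simp
    have 2: "\<bar>spec \<Phi> (window n) g undefined - spec \<Phi> (window n) h undefined\<bar> \<le> e / 3" for n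
      using spec_abs_le[OF finite_window, of "\<lambda>\<omega>. g \<omega> - h \<omega>" "e / 3" \<Phi> n undefined] h(3)
      by (simp add: spec_diff)
    obtain N where N: "\<And>n. N \<le> n \<Longrightarrow> \<bar>spec \<Phi> (window n) h undefined - state h\<bar> < e / 3"
      using LIMSEQ_D[OF state_LIMSEQ[OF h(1,2)], of "e / 3"] \<open>e > 0\<close> by auto
    have "\<bar>spec \<Phi> (window n) g undefined - (\<integral>\<omega>. g \<omega> \<partial>\<mu>)\<bar> < e" if "N \<le> n" for n
      using 1 2[of n] N[OF that] by linarith
    then show "\<exists>N. \<forall>n\<ge>N. norm (spec \<Phi> (window n) g undefined - (\<integral>\<omega>. g \<omega> \<partial>\<mu>)) < e" by auto
  qed
  have "gibbs \<Phi> \<mu>"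
  proof (rule gibbsI_cylinder[OF \<mu>])
    fix \<Lambda> J :: "int set" and f :: "'a config \<Rightarrow> real"
    assume \<Lambda>: "finite \<Lambda>" and J: "finite J" "depends_on J f"
    obtain B where B: "\<And>\<omega>. \<bar>f \<omega>\<bar> \<le> B" using depends_on_bounded[OF J] by blast
    have qf: "quasilocal f" using J by (rule depends_on_quasilocal)
    have "(\<lambda>n. spec \<Phi> (window n) (spec \<Phi> \<Lambda> f) undefined) \<longlonglongrightarrow> (\<integral>\<eta>. spec \<Phi> \<Lambda> f \<eta> \<partial>\<mu>)"
      by (rule lim[OF quasilocal_spec[OF \<Lambda> qf B] spec_abs_le[OF \<Lambda> B]])
    moreover have "eventually (\<lambda>n. spec \<Phi> (window n) (spec \<Phi> \<Lambda> f) undefined = spec \<Phi> (window n) f undefined) sequentially"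
      using eventually_subset_window[OF \<Lambda>] by eventually_elim (simp add: spec_consistent finite_window)
    ultimately have "(\<lambda>n. spec \<Phi> (window n) f undefined) \<longlonglongrightarrow> (\<integral>\<eta>. spec \<Phi> \<Lambda> f \<eta> \<partial>\<mu>)"
      by (rule Lim_transform_eventually)
    then show "(\<integral>\<eta>. spec \<Phi> \<Lambda> f \<eta> \<partial>\<mu>) = (\<integral>\<eta>. f \<eta> \<partial>\<mu>)"
      using lim[OF qf B] by (rule LIMSEQ_unique)
  qed
  then show ?thesis by blast
qed

lemma gibbs_ex1: "\<exists>!\<mu>. gibbs \<Phi> \<mu>"
  using gibbs_exists gibbs_unique by blast

end

section \<open>Finite perturbations and relative entropy\<close>

lemma sup_norm_zero: "sup_norm (\<lambda>_. 0) = 0"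
  by (simp add: sup_norm_def)

lemma osc_zero: "osc (\<lambda>_. 0) = 0"
  by (simp add: osc_def)

lemma psi_cases: "psi \<Phi> enum k V = (\<lambda>_. 0) \<or> psi \<Phi> enum k V = \<Phi> V"
  by (simp add: psi_def)

lemma uac_interaction_psi:
  assumes "interaction \<Phi>" "UAC \<Phi>" shows "uac_interaction (psi \<Phi> enum k)"
proof
  show "interaction (psi \<Phi> enum k)"
    using assms(1) unfolding interaction_def psi_def by simp
  have "ennreal (sup_norm (psi \<Phi> enum k V)) \<le> ennreal (sup_norm (\<Phi> V))" for V
    using psi_cases[of \<Phi> enum k V] by (auto simp: sup_norm_zero)
  then have "(SUP i::int. infsum (\<lambda>V. ennreal (sup_norm (psi \<Phi> enum k V))) {V. finite V \<and> i \<in> V})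
      \<le> (SUP i::int. infsum (\<lambda>V. ennreal (sup_norm (\<Phi> V))) {V. finite V \<and> i \<in> V})"
    by (intro SUP_mono' infsum_mono nonneg_summable_on_complete) auto
  also have "\<dots> < \<top>" using assms(2) unfolding UAC_def .
  finally show "UAC (psi \<Phi> enum k)" unfolding UAC_def .
qed

lemma dobrushin_interaction_psi:
  assumes "interaction \<Phi>" "UAC \<Phi>" "dobrushin_c \<Phi> < 1"
  shows "dobrushin_interaction (psi \<Phi> enum k)"
proof (intro dobrushin_interaction.intro uac_interaction_psi assms dobrushin_interaction_axioms.intro)
  have "ennreal ((real (card V) - 1) * osc (psi \<Phi> enum k V)) \<le> ennreal ((real (card V) - 1) * osc (\<Phi> V))" for V
    using psi_cases[of \<Phi> enum k V] by (auto simp: osc_zero)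
  then have "dobrushin_c (psi \<Phi> enum k) \<le> dobrushin_c \<Phi>"
    unfolding dobrushin_c_def by (intro mult_left_mono SUP_mono' infsum_mono nonneg_summable_on_complete) auto
  also have "\<dots> < 1" by fact
  finally show "dobrushin_c (psi \<Phi> enum k) < 1" .
qed

text \<open>Applied with \<Phi> and \<Psi> standing for \<open>psi \<Phi> enum 0\<close> and
  \<open>psi \<Phi> enum k\<close>, and with the first \<open>k\<close> crossing sets as
  \<open>\<V>\<close>.\<close>

locale finite_perturbation =
  \<Phi>: uac_interaction \<Phi> + \<Psi>: uac_interaction \<Psi>
  for \<Phi> \<Psi> :: "('e::finite) interaction" +
  fixes \<V> :: "int set set"
  assumes finite_\<V>: "finite \<V>" "\<And>V. V \<in> \<V> \<Longrightarrow> finite V"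
    and eq_outside: "\<And>V. V \<notin> \<V> \<Longrightarrow> \<Psi> V = \<Phi> V"
begin

definition energy :: "'e config \<Rightarrow> real" where
  "energy \<omega> = (\<Sum>V\<in>\<V>. \<Psi> V \<omega> - \<Phi> V \<omega>)"

text \<open>The part of \<open>energy\<close> that the Hamiltonian in \<Lambda> does not see. It
  depends only on the boundary and therefore disappears on normalising.\<close>

definition energy_outside :: "int set \<Rightarrow> 'e config \<Rightarrow> real" where
  "energy_outside \<Lambda> \<omega> = (\<Sum>V\<in>{V\<in>\<V>. V \<inter> \<Lambda> = {}}. \<Psi> V \<omega> - \<Phi> V \<omega>)"

lemma energy_depends_on: "depends_on (\<Union>\<V>) energy"
  unfolding depends_on_def energy_def
proof (intro allI impI sum.cong refl)
  fix \<xi> \<eta> :: "'e config" and V assume "\<forall>i\<in>\<Union>\<V>. \<xi> i = \<eta> i" "V \<in> \<V>"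
  then have "\<Psi> V \<xi> = \<Psi> V \<eta>" "\<Phi> V \<xi> = \<Phi> V \<eta>"
    using finite_\<V>(2) by (auto intro!: \<Psi>.potential_cong \<Phi>.potential_cong)
  then show "\<Psi> V \<xi> - \<Phi> V \<xi> = \<Psi> V \<eta> - \<Phi> V \<eta>" by simp
qed

lemma finite_support: "finite (\<Union>\<V>)"
  using finite_\<V> by blast

lemma energy_measurable: "energy \<in> borel_measurable cfgM"
  by (rule depends_on_measurable[OF finite_support energy_depends_on])

lemma energy_bounded: obtains B where "\<And>\<omega>. \<bar>energy \<omega>\<bar> \<le> B"
  using depends_on_bounded[OF finite_support energy_depends_on] by blast

lemma energy_outside_cong: "\<omega> \<in> agree_out \<Lambda> \<eta> \<Longrightarrow> energy_outside \<Lambda> \<omega> = energy_outside \<Lambda> \<eta>"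
  unfolding energy_outside_def
proof (intro sum.cong refl)
  fix V assume \<omega>: "\<omega> \<in> agree_out \<Lambda> \<eta>" and V: "V \<in> {V\<in>\<V>. V \<inter> \<Lambda> = {}}"
  then have "\<Psi> V \<omega> = \<Psi> V \<eta>" "\<Phi> V \<omega> = \<Phi> V \<eta>"
    using finite_\<V>(2) by (auto intro!: \<Psi>.potential_cong \<Phi>.potential_cong simp: agree_out_def)
  then show "\<Psi> V \<omega> - \<Phi> V \<omega> = \<Psi> V \<eta> - \<Phi> V \<eta>" by simp
qed

lemma hamiltonian_perturbation:
  assumes \<Lambda>: "finite \<Lambda>"
  shows "hamiltonian \<Psi> \<Lambda> \<omega> = hamiltonian \<Phi> \<Lambda> \<omega> + energy \<omega> - energy_outside \<Lambda> \<omega>"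
proof -
  let ?d = "\<lambda>V. \<Psi> V \<omega> - \<Phi> V \<omega>"
  have "hamiltonian \<Psi> \<Lambda> \<omega> - hamiltonian \<Phi> \<Lambda> \<omega> = infsum ?d (touching \<Lambda>)"
    using infsum_add[OF \<Psi>.summable_potential[OF \<Lambda>, of \<omega>]
      summable_on_uminus[THEN iffD2, OF \<Phi>.summable_potential[OF \<Lambda>, of \<omega>]]]
    by (simp add: \<Psi>.hamiltonian_eq \<Phi>.hamiltonian_eq infsum_uminus)
  also have "\<dots> = infsum ?d {V\<in>\<V>. V \<inter> \<Lambda> \<noteq> {}}"
    by (rule infsum_cong_neutral) (use finite_\<V>(2) in \<open>auto simp: touching_def eq_outside\<close>)
  also have "\<dots> = sum ?d {V\<in>\<V>. V \<inter> \<Lambda> \<noteq> {}}" using finite_\<V> by simp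
  also have "\<dots> = energy \<omega> - energy_outside \<Lambda> \<omega>"
  proof -
    have "energy \<omega> = sum ?d ({V\<in>\<V>. V \<inter> \<Lambda> \<noteq> {}} \<union> {V\<in>\<V>. V \<inter> \<Lambda> = {}})"
      unfolding energy_def by (rule sum.cong) auto
    also have "\<dots> = sum ?d {V\<in>\<V>. V \<inter> \<Lambda> \<noteq> {}} + energy_outside \<Lambda> \<omega>"
      unfolding energy_outside_def using finite_\<V> by (intro sum.union_disjoint) auto
    finally show ?thesis by simp
  qed
  finally show ?thesis by simp
qed

text \<open>The two weights differ by \<open>exp (- energy \<omega>)\<close> times a factor that is
  constant on the fibre and cancels. The product form avoids a quotient of averages that would
  depend on \<eta>.\<close>

lemma spec_perturbation:
  assumes \<Lambda>: "finite \<Lambda>"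
  shows "spec \<Psi> \<Lambda> f \<eta> * spec \<Phi> \<Lambda> (\<lambda>\<omega>. exp (- energy \<omega>)) \<eta>
    = spec \<Phi> \<Lambda> (\<lambda>\<omega>. f \<omega> * exp (- energy \<omega>)) \<eta>"
proof -
  let ?S = "agree_out \<Lambda> \<eta>" and ?r = "exp (energy_outside \<Lambda> \<eta>)"
  let ?w = "\<lambda>\<omega>. exp (- energy \<omega>) * exp (- hamiltonian \<Phi> \<Lambda> \<omega>)"
  have w: "exp (- hamiltonian \<Psi> \<Lambda> \<omega>) = ?r * ?w \<omega>" if "\<omega> \<in> ?S" for \<omega>
    using energy_outside_cong[OF that]
    by (simp add: hamiltonian_perturbation[OF \<Lambda>] flip: exp_add)
  have num: "(\<Sum>\<omega>\<in>?S. f \<omega> * exp (- hamiltonian \<Psi> \<Lambda> \<omega>)) = ?r * (\<Sum>\<omega>\<in>?S. f \<omega> * ?w \<omega>)"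
    unfolding sum_distrib_left by (rule sum.cong) (auto simp: w)
  have den: "(\<Sum>\<omega>\<in>?S. exp (- hamiltonian \<Psi> \<Lambda> \<omega>)) = ?r * (\<Sum>\<omega>\<in>?S. ?w \<omega>)"
    unfolding sum_distrib_left by (rule sum.cong) (auto simp: w)
  have "(\<Sum>\<omega>\<in>?S. ?w \<omega>) > 0"
    using finite_agree_out[OF \<Lambda>] self_in_agree_out by (intro sum_pos) auto
  then show ?thesis
    unfolding spec_def num den by (simp add: mult.assoc)
qed

text \<open>The kernel of \<Psi> is constant on fibres, so it can be pulled out of an average over
  \<Phi>. \<open>spec_perturbation\<close> then turns it into an average of the tilted indicator,
  and the Gibbs equation of \<mu> is applied once before and once after this exchange.\<close>

lemma gibbs_density:
  assumes g: "gibbs \<Phi> \<mu>"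
  defines "Z \<equiv> (\<integral>\<omega>. exp (- energy \<omega>) \<partial>\<mu>)"
  shows "gibbs \<Psi> (density \<mu> (\<lambda>\<omega>. ennreal (exp (- energy \<omega>) / Z)))" and "Z > 0"
proof -
  interpret prob_space \<mu> using g by (simp add: gibbs_def)
  have S: "sets \<mu> = sets cfgM" using g by (simp add: gibbs_def)
  have sp: "space \<mu> = UNIV" using sets_eq_imp_space_eq[OF S] by (simp add: space_cfgM)
  have m: "h \<in> borel_measurable cfgM \<Longrightarrow> h \<in> borel_measurable \<mu>" for h :: "'e config \<Rightarrow> real"
    using measurable_cong_sets[OF S refl] by blast
  obtain B where B: "\<And>\<omega>. \<bar>energy \<omega>\<bar> \<le> B" using energy_bounded by blast
  let ?e = "\<lambda>\<omega>. exp (- energy \<omega>)"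
  have em: "?e \<in> borel_measurable cfgM" using energy_measurable by measurable
  have eb: "\<bar>?e \<omega>\<bar> \<le> exp B" for \<omega> using B[of \<omega>] by (simp add: abs_le_iff)
  have e_lower: "exp (- B) \<le> ?e \<omega>" for \<omega> using B[of \<omega>] by (simp add: abs_le_iff)
  have ei: "integrable \<mu> ?e" by (rule integrable_const_bound[of _ "exp B", OF _ m[OF em]]) (simp add: eb[simplified])
  have "exp (- B) \<le> Z" unfolding Z_def using ei e_lower by (intro integral_ge_const) auto
  then show Z: "Z > 0" using exp_gt_zero[of "- B"] by linarith
  let ?f = "\<lambda>\<omega>. ?e \<omega> / Z"
  have fm: "?f \<in> borel_measurable \<mu>" using m[OF em] by measurable
  have fnn: "0 \<le> ?f \<omega>" for \<omega> using Z by simp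
  let ?\<nu> = "density \<mu> (\<lambda>\<omega>. ennreal (?f \<omega>))"
  have density_integral: "(\<integral>\<omega>. q \<omega> \<partial>?\<nu>) = (\<integral>\<omega>. ?e \<omega> * q \<omega> \<partial>\<mu>) / Z"
    if "q \<in> borel_measurable cfgM" for q :: "'e config \<Rightarrow> real"
    using integral_density[OF m[OF that] fm] fnn by simp
  show "gibbs \<Psi> ?\<nu>"
    unfolding gibbs_def gibbs_kernel_eq_spec
  proof (intro conjI allI impI ballI)
    have "emeasure ?\<nu> (space \<mu>) = (\<integral>\<^sup>+\<omega>. ennreal (?f \<omega>) \<partial>\<mu>)"
      using fm by (subst emeasure_density) (auto intro!: nn_integral_cong)
    also have "\<dots> = ennreal (\<integral>\<omega>. ?f \<omega> \<partial>\<mu>)"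
      using ei fnn by (intro nn_integral_eq_integral) auto
    also have "\<dots> = 1" using Z by (simp add: Z_def)
    finally show "prob_space ?\<nu>" by (intro prob_spaceI) simp
    show "sets ?\<nu> = sets cfgM" using S by simp
    fix \<Lambda> :: "int set" and A :: "'e config set" assume \<Lambda>: "finite \<Lambda>" and A: "A \<in> sets cfgM"
    let ?g = "spec \<Psi> \<Lambda> (indicator A)"
    have Am: "indicator A \<in> borel_measurable cfgM" using A by simp
    have gm: "?g \<in> borel_measurable cfgM" by (rule \<Psi>.spec_measurable[OF \<Lambda> Am])
    have gb: "\<bar>?g \<omega>\<bar> \<le> 1" for \<omega> by (rule spec_abs_le[OF \<Lambda> abs_indicator_le])
    have b: "\<bar>q \<omega> * ?e \<omega>\<bar> \<le> exp B" if "\<bar>q \<omega>\<bar> \<le> 1" for q :: "'e config \<Rightarrow> real" and \<omega>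
      using mult_mono[OF that eb[of \<omega>]] by (simp add: abs_mult)
    have gb': "\<bar>?g \<omega> * ?e \<omega>\<bar> \<le> exp B" for \<omega> by (rule b[OF gb])
    have Ab': "\<bar>indicator A \<omega> * ?e \<omega>\<bar> \<le> exp B" for \<omega> by (rule b[OF abs_indicator_le])
    have "(\<integral>\<omega>. ?e \<omega> * ?g \<omega> \<partial>\<mu>) = (\<integral>\<omega>. ?g \<omega> * ?e \<omega> \<partial>\<mu>)" by (simp add: mult.commute)
    also have "\<dots> = (\<integral>\<eta>. spec \<Phi> \<Lambda> (\<lambda>\<omega>. ?g \<omega> * ?e \<omega>) \<eta> \<partial>\<mu>)"
      by (rule \<Phi>.integral_spec[OF g \<Lambda> borel_measurable_times[OF gm em] gb', symmetric])
    also have "\<dots> = (\<integral>\<eta>. spec \<Phi> \<Lambda> (\<lambda>\<omega>. indicator A \<omega> * ?e \<omega>) \<eta> \<partial>\<mu>)"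
    proof (rule Bochner_Integration.integral_cong[OF refl])
      fix \<eta>
      have "spec \<Phi> \<Lambda> (\<lambda>\<omega>. ?g \<omega> * ?e \<omega>) \<eta> = ?g \<eta> * spec \<Phi> \<Lambda> ?e \<eta>"
        by (rule spec_pull_out) (rule spec_agree)
      also have "\<dots> = spec \<Phi> \<Lambda> (\<lambda>\<omega>. indicator A \<omega> * ?e \<omega>) \<eta>" by (rule spec_perturbation[OF \<Lambda>])
      finally show "spec \<Phi> \<Lambda> (\<lambda>\<omega>. ?g \<omega> * ?e \<omega>) \<eta> = \<dots>" .
    qed
    also have "\<dots> = (\<integral>\<omega>. indicator A \<omega> * ?e \<omega> \<partial>\<mu>)"
      by (rule \<Phi>.integral_spec[OF g \<Lambda> borel_measurable_times[OF Am em] Ab'])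
    also have "\<dots> = (\<integral>\<omega>. ?e \<omega> * indicator A \<omega> \<partial>\<mu>)" by (simp add: mult.commute)
    finally have "(\<integral>\<omega>. ?g \<omega> \<partial>?\<nu>) = (\<integral>\<omega>. indicator A \<omega> \<partial>?\<nu>)"
      by (simp only: density_integral[OF gm] density_integral[OF Am])
    also have "\<dots> = measure ?\<nu> A" using A S by (simp add: sp)
    finally show "measure ?\<nu> A = (\<integral>\<omega>. ?g \<omega> \<partial>?\<nu>)" ..
  qed
qed

end

text \<open>The relative entropy of \<open>density M f\<close> with respect to \<open>M\<close> is
  \<open>- \<integral>h dN - ln Z\<close>, and Jensen's inequality bounds \<open>- ln Z\<close> by \<open>\<integral>h dM\<close>.\<close>

lemma (in prob_space) gibbs_tilt_tail_le:
  fixes h :: "'a \<Rightarrow> real"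
  assumes h: "h \<in> borel_measurable M" "\<And>x. \<bar>h x\<bar> \<le> B"
    and Z_def: "Z = (\<integral>x. exp (- h x) \<partial>M)"
    and N_def: "N = density M (\<lambda>x. ennreal (exp (- h x) / Z))"
    and R: "\<bar>\<integral>x. h x \<partial>M\<bar> \<le> R" "\<bar>\<integral>x. h x \<partial>N\<bar> \<le> R" and t: "t > 1"
  shows "(\<integral>\<^sup>+x. RN_deriv M N x * indicator {x. ennreal t < RN_deriv M N x} x \<partial>M)
      \<le> ennreal ((2 * R + 1) / ln t)"
proof -
  let ?e = "\<lambda>x. exp (- h x)" and ?f = "\<lambda>x. exp (- h x) / Z"
  define m where "m = (\<integral>x. h x \<partial>M)"
  have em: "?e \<in> borel_measurable M" using h(1) by measurable
  have hB: "- h x \<le> B" for x using h(2)[of x] by linarith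
  then have eb: "?e x \<le> exp B" for x by simp
  have ei: "integrable M ?e" by (rule integrable_const_bound[of _ "exp B", OF _ em]) (simp add: hB)
  have hi: "integrable M h" by (rule integrable_const_bound[of _ B, OF _ h(1)]) (simp add: h(2))
  have heb: "\<bar>?e x * h x\<bar> \<le> exp B * B" for x
    using mult_mono[OF eb h(2), of x x] by (simp add: abs_mult)
  have hei: "integrable M (\<lambda>x. ?e x * h x)"
    by (rule integrable_const_bound[of _ "exp B * B", OF _ borel_measurable_times[OF em h(1)]])
      (simp add: heb)
  \<comment> \<open>Jensen by hand: the tangent inequality \<open>1 + y \<le> exp y\<close> at
    \<open>y = m - h x\<close> is integrated, and the linear term vanishes because \<open>m\<close>
    is the mean of \<open>h\<close>.\<close>
  have "exp (- m) = (\<integral>x. exp (- m) * (1 + (m - h x)) \<partial>M)"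
    using hi by (simp add: m_def prob_space)
  also have "\<dots> \<le> (\<integral>x. ?e x \<partial>M)"
  proof (rule integral_mono[OF _ ei])
    show "integrable M (\<lambda>x. exp (- m) * (1 + (m - h x)))" using hi by simp
    show "exp (- m) * (1 + (m - h x)) \<le> ?e x" for x
    proof -
      have "exp (- m) * (1 + (m - h x)) \<le> exp (- m) * exp (m - h x)"
        by (intro mult_left_mono exp_ge_add_one_self) simp
      also have "\<dots> = ?e x" by (simp flip: exp_add)
      finally show ?thesis .
    qed
  qed
  finally have Zm: "exp (- m) \<le> Z" by (simp add: Z_def)
  then have Z: "Z > 0" using exp_gt_zero[of "- m"] by linarith
  have lnZ: "- ln Z \<le> m" using Zm Z by (simp add: ln_ge_iff minus_le_iff)
  have fm: "?f \<in> borel_measurable M" using em by measurable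
  have ln_f: "ln (?f x) = - h x - ln Z" for x using Z by (simp add: ln_div)
  \<comment> \<open>One \<open>R\<close> bounds the integral of \<open>h\<close> under
    \<open>N\<close>, the other bounds \<open>- ln Z\<close> through the mean under
    \<open>M\<close>.\<close>
  have entropy: "(\<integral>x. ?f x * (- h x - ln Z) \<partial>M) \<le> 2 * R"
  proof -
    have "(\<integral>x. h x \<partial>N) = (\<integral>x. ?f x * h x \<partial>M)"
      unfolding N_def using integral_density[OF h(1) fm] Z by simp
    moreover have "?f x * (- h x - ln Z) = - (?e x * h x) / Z - ln Z / Z * ?e x" for x
      by (simp add: algebra_simps diff_divide_distrib)
    moreover have "(\<integral>x. - (?e x * h x) / Z - ln Z / Z * ?e x \<partial>M)
        = - (\<integral>x. ?e x * h x \<partial>M) / Z - ln Z / Z * Z"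
      using hei ei by (simp add: Z_def[symmetric])
    moreover have "(\<integral>x. ?f x * h x \<partial>M) = (\<integral>x. ?e x * h x \<partial>M) / Z" by simp
    ultimately have "(\<integral>x. ?f x * (- h x - ln Z) \<partial>M) = - (\<integral>x. h x \<partial>N) - ln Z"
      using Z by simp
    then show ?thesis using R lnZ unfolding m_def by linarith
  qed
  have fi: "integrable M (\<lambda>x. ?f x * (- h x - ln Z))"
  proof -
    have "integrable M (\<lambda>x. - (?e x * h x) / Z - ln Z / Z * ?e x)" using hei ei by simp
    moreover have "- (?e x * h x) / Z - ln Z / Z * ?e x = ?f x * (- h x - ln Z)" for x
      by (simp add: algebra_simps diff_divide_distrib)
    ultimately show ?thesis by simp
  qed
  have lnt: "ln t > 0" using t by simp
  \<comment> \<open>The integrand is \<open>?f x * ln (?f x)\<close>, which can be negative where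
    the density is below 1. Adding 1 repairs this, by \<open>ln y \<le> y - 1\<close> at the inverse
    of the density, and is the source of the 1 in the bound.\<close>
  have nonneg: "0 \<le> ?f x * (- h x - ln Z) + 1" for x
  proof -
    have fpos: "0 < ?f x" using Z by simp
    have "- ln (?f x) \<le> inverse (?f x) - 1"
      using ln_le_minus_one[of "inverse (?f x)"] fpos by (simp only: ln_inverse inverse_positive_iff_positive)
    then have "?f x * (- ln (?f x)) \<le> ?f x * (inverse (?f x) - 1)"
      using fpos by (intro mult_left_mono) auto
    also have "\<dots> = 1 - ?f x" using Z by (simp add: right_diff_distrib)
    finally have "0 \<le> ?f x * ln (?f x) + 1" using fpos unfolding mult_minus_right by linarith
    then show ?thesis unfolding ln_f .
  qed
  \<comment> \<open>Where the density exceeds \<open>t\<close>, its logarithm exceeds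
    \<open>ln t\<close>; elsewhere the left side is zero and nonnegativity of the right side
    suffices.\<close>
  have pointwise: "ennreal (?f x) * indicator {x. ennreal t < ennreal (?f x)} x
      \<le> ennreal ((?f x * (- h x - ln Z) + 1) / ln t)" for x
  proof (cases "t < ?f x")
    case True
    have fpos: "0 < ?f x" using Z by simp
    have "ln t \<le> ln (?f x)" using True t by simp
    then have "?f x * ln t \<le> ?f x * (- h x - ln Z)" using fpos unfolding ln_f by (intro mult_left_mono) auto
    then have "?f x \<le> (?f x * (- h x - ln Z) + 1) / ln t" using lnt by (simp add: pos_le_divide_eq)
    then show ?thesis using True by (simp add: ennreal_leI split: split_indicator)
  next
    case False
    then show ?thesis using t by (simp add: ennreal_less_iff split: split_indicator)
  qed
  have "AE x in M. ennreal (?f x) = RN_deriv M N x"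
    by (rule RN_deriv_unique) (use fm in \<open>auto simp: N_def\<close>)
  then have "(\<integral>\<^sup>+x. RN_deriv M N x * indicator {x. ennreal t < RN_deriv M N x} x \<partial>M)
      = (\<integral>\<^sup>+x. ennreal (?f x) * indicator {x. ennreal t < ennreal (?f x)} x \<partial>M)"
    by (intro nn_integral_cong_AE) (auto split: split_indicator)
  also have "\<dots> \<le> (\<integral>\<^sup>+x. ennreal ((?f x * (- h x - ln Z) + 1) / ln t) \<partial>M)"
    by (rule nn_integral_mono) (rule pointwise)
  also have "\<dots> = ennreal (\<integral>x. (?f x * (- h x - ln Z) + 1) / ln t \<partial>M)"
  proof (rule nn_integral_eq_integral)
    show "integrable M (\<lambda>x. (?f x * (- h x - ln Z) + 1) / ln t)"
      by (intro integrable_divide Bochner_Integration.integrable_add fi integrable_const)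
    show "AE x in M. 0 \<le> (?f x * (- h x - ln Z) + 1) / ln t"
      using nonneg lnt by (intro AE_I2 divide_nonneg_pos)
  qed
  also have "(\<integral>x. (?f x * (- h x - ln Z) + 1) / ln t \<partial>M)
      = ((\<integral>x. ?f x * (- h x - ln Z) \<partial>M) + 1) / ln t"
    unfolding integral_divide_zero
    by (subst Bochner_Integration.integral_add[OF fi integrable_const]) (simp add: prob_space)
  also have "ennreal \<dots> \<le> ennreal ((2 * R + 1) / ln t)"
    using entropy lnt by (intro ennreal_leI divide_right_mono) auto
  finally show ?thesis .
qed

section \<open>Uniform integrability of the densities\<close>

theorem theoremE:
  fixes \<Phi> :: "('e::finite) interaction" and enum :: "nat \<Rightarrow> int set"
  assumes "interaction \<Phi>" and "UAC \<Phi>"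
    and "bij_betw enum {1..} crossing"
    and "dobrushin_c \<Phi> < 1"
    and "infsum (\<lambda>k. delta_norm2_sq (\<Phi> (enum k))) {1..} < \<top>"
    and "infsum (\<lambda>k. ennreal (rho \<Phi> enum k)) {1..} < \<top>"
  shows "(\<exists>!\<mu>. gibbs (psi \<Phi> enum 0) \<mu>) \<and>
         unif_integrable (nu \<Phi> enum 0) (\<lambda>k. RN_deriv (nu \<Phi> enum 0) (nu \<Phi> enum k))"
proof
  interpret \<Phi>: uac_interaction \<Phi> using assms by unfold_locales
  note ex1 = dobrushin_interaction.gibbs_ex1[OF dobrushin_interaction_psi[OF assms(1,2,4)]]
  show "\<exists>!\<mu>. gibbs (psi \<Phi> enum 0) \<mu>" by (rule ex1)
  have nu: "gibbs (psi \<Phi> enum k) (nu \<Phi> enum k)" for k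
    unfolding nu_def by (rule theI'[OF ex1])
  have prob: "prob_space (nu \<Phi> enum k)" and sets_nu: "sets (nu \<Phi> enum k) = sets cfgM" for k
    using nu[of k] by (simp_all add: gibbs_def)
  have meas: "h \<in> borel_measurable (nu \<Phi> enum k)" if "h \<in> borel_measurable cfgM"
    for h :: "'e config \<Rightarrow> real" and k
    using that measurable_cong_sets[OF sets_nu refl] by blast
  have fin: "finite (enum i)" if "1 \<le> i" for i
    using bij_betwE[OF assms(3)] that by (auto simp: crossing_def)
  have pot_meas: "\<Phi> (enum i) \<in> borel_measurable cfgM" if "1 \<le> i" for i
    by (rule depends_on_measurable[OF fin[OF that]])
      (auto simp: depends_on_def intro: \<Phi>.potential_cong[OF fin[OF that]])
  have pot_int: "integrable (nu \<Phi> enum n) (\<Phi> (enum i))" if "1 \<le> i" for i n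
    using prob_space.finite_measure[OF prob] \<Phi>.abs_potential_le[OF fin[OF that]]
    by (intro finite_measure.integrable_const_bound[of _ _ "sup_norm (\<Phi> (enum i))"])
      (auto intro: meas pot_meas[OF that])
  \<comment> \<open>\<open>rho\<close> is a supremum of reals, so it dominates its members only once
    the family is known to be bounded; the norm of the potential is a bound.\<close>
  have rho: "\<bar>\<integral>x. \<Phi> (enum i) x \<partial>(nu \<Phi> enum n)\<bar> \<le> rho \<Phi> enum i" if "1 \<le> i" for i n
    unfolding rho_def
  proof (rule cSUP_upper)
    have "\<bar>(\<integral>x. \<Phi> (enum i) x \<partial>(nu \<Phi> enum n)) - 0\<bar> \<le> sup_norm (\<Phi> (enum i))" for n
      by (rule prob_space.abs_integral_diff_le[OF prob meas[OF pot_meas[OF that]]])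
        (simp add: \<Phi>.abs_potential_le[OF fin[OF that]])
    then show "bdd_above (range (\<lambda>n. \<bar>\<integral>x. \<Phi> (enum i) x \<partial>(nu \<Phi> enum n)\<bar>))"
      by (intro bdd_aboveI2[of _ _ "sup_norm (\<Phi> (enum i))"]) simp
  qed simp
  have rho_nonneg: "0 \<le> rho \<Phi> enum i" if "1 \<le> i" for i
    using rho[OF that, of 0] by (rule order_trans[rotated]) simp
  define R where "R = enn2real (infsum (\<lambda>k. ennreal (rho \<Phi> enum k)) {1..})"
  have R: "(\<Sum>i\<in>{1..k}. rho \<Phi> enum i) \<le> R" for k
  proof -
    have "infsum (\<lambda>k. ennreal (rho \<Phi> enum k)) {1..} \<le> ennreal R"
      unfolding R_def using assms(6) by simp
    from summable_on_if_ennreal_infsum_le[OF _ this] rho_nonneg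
    have s: "rho \<Phi> enum summable_on {1..}" "infsum (rho \<Phi> enum) {1..} \<le> R"
      by (auto simp: R_def)
    have "(\<Sum>i\<in>{1..k}. rho \<Phi> enum i) \<le> infsum (rho \<Phi> enum) {1..}"
      by (rule finite_sum_le_infsum[OF s(1)]) (auto intro: rho_nonneg)
    with s(2) show ?thesis by linarith
  qed
  interpret \<nu>: prob_space "nu \<Phi> enum 0" by (rule prob)
  have tail: "(\<integral>\<^sup>+x. RN_deriv (nu \<Phi> enum 0) (nu \<Phi> enum k) x
        * indicator {x. ennreal t < RN_deriv (nu \<Phi> enum 0) (nu \<Phi> enum k) x} x \<partial>(nu \<Phi> enum 0))
      \<le> ennreal ((2 * R + 1) / ln t)" if t: "t > 1" for k t
  proof -
    let ?V = "enum ` {1..k}"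
    have inj: "inj_on enum {1..}" using assms(3) by (rule bij_betw_imp_inj_on)
    interpret P: finite_perturbation "psi \<Phi> enum 0" "psi \<Phi> enum k" ?V
    proof (intro finite_perturbation.intro finite_perturbation_axioms.intro uac_interaction_psi assms)
      fix V assume "V \<notin> ?V"
      \<comment> \<open>\<open>psi \<Phi> enum 0\<close> drops every crossing set and
        \<open>psi \<Phi> enum k\<close> all but the first \<open>k\<close>. \<open>Suc 0\<close> is
        the simplified form of \<open>0 + 1\<close> in the definition of \<open>psi\<close>.\<close>
      moreover have "{Suc 0..} = {1..k} \<union> {k + 1..}" by auto
      ultimately have "V \<in> enum ` {Suc 0..} \<longleftrightarrow> V \<in> enum ` {k + 1..}" by (metis UnE UnI2 image_Un)
      then show "psi \<Phi> enum k V = psi \<Phi> enum 0 V" by (simp add: psi_def)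
    qed (use fin in auto)
    have energy: "P.energy \<omega> = (\<Sum>i\<in>{1..k}. \<Phi> (enum i) \<omega>)" for \<omega>
    proof -
      have "P.energy \<omega> = (\<Sum>i\<in>{1..k}. psi \<Phi> enum k (enum i) \<omega> - psi \<Phi> enum 0 (enum i) \<omega>)"
        unfolding P.energy_def
        by (rule sum.reindex_cong[OF inj_on_subset[OF inj]]) auto
      also have "\<dots> = (\<Sum>i\<in>{1..k}. \<Phi> (enum i) \<omega>)"
      proof (rule sum.cong[OF refl])
        fix i assume i: "i \<in> {1..k}"
        \<comment> \<open>Injectivity excludes that a set reinstated at index \<open>i\<close> is
          dropped again under a later index.\<close>
        have "enum i \<notin> enum ` {k + 1..}"
        proof
          assume "enum i \<in> enum ` {k + 1..}"
          then obtain j where "j \<ge> k + 1" "enum i = enum j" by auto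
          then show False using inj_onD[OF inj, of i j] i by auto
        qed
        moreover have "enum i \<in> enum ` {0 + 1..}" using i by auto
        ultimately show "psi \<Phi> enum k (enum i) \<omega> - psi \<Phi> enum 0 (enum i) \<omega> = \<Phi> (enum i) \<omega>"
          by (simp add: psi_def)
      qed
      finally show ?thesis .
    qed
    \<comment> \<open>The bound holds for all \<open>n\<close>; the cases 0 and \<open>k\<close> are
      the two integrals in the entropy estimate.\<close>
    have energy_le: "\<bar>\<integral>x. P.energy x \<partial>(nu \<Phi> enum n)\<bar> \<le> R" for n
    proof -
      have "(\<integral>x. P.energy x \<partial>(nu \<Phi> enum n)) = (\<Sum>i\<in>{1..k}. \<integral>x. \<Phi> (enum i) x \<partial>(nu \<Phi> enum n))"
        unfolding energy by (rule Bochner_Integration.integral_sum) (auto intro: pot_int)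
      also have "\<bar>\<dots>\<bar> \<le> (\<Sum>i\<in>{1..k}. rho \<Phi> enum i)"
        by (rule order_trans[OF sum_abs sum_mono]) (auto intro: rho)
      also have "\<dots> \<le> R" by (rule R)
      finally show ?thesis .
    qed
    let ?Z = "\<integral>x. exp (- P.energy x) \<partial>(nu \<Phi> enum 0)"
    have "gibbs (psi \<Phi> enum k) (density (nu \<Phi> enum 0) (\<lambda>\<omega>. ennreal (exp (- P.energy \<omega>) / ?Z)))"
      by (rule P.gibbs_density(1)[OF nu])
    then have nu_k: "nu \<Phi> enum k = density (nu \<Phi> enum 0) (\<lambda>\<omega>. ennreal (exp (- P.energy \<omega>) / ?Z))"
      unfolding nu_def[of \<Phi> enum k] by (rule the1_equality[OF ex1])
    obtain B where B: "\<And>\<omega>. \<bar>P.energy \<omega>\<bar> \<le> B" using P.energy_bounded by blast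
    show ?thesis
      by (rule \<nu>.gibbs_tilt_tail_le[OF meas[OF P.energy_measurable] B refl nu_k energy_le energy_le t])
  qed
  show "unif_integrable (nu \<Phi> enum 0) (\<lambda>k. RN_deriv (nu \<Phi> enum 0) (nu \<Phi> enum k))"
    unfolding unif_integrable_def
  \<comment> \<open>The tail bound does not depend on \<open>k\<close>, so it bounds the supremum as
    well, and it vanishes because \<open>ln t\<close> tends to infinity.\<close>
  proof (rule tendsto_sandwich[OF _ _ tendsto_const])
    show "((\<lambda>t. ennreal ((2 * R + 1) / ln t)) \<longlongrightarrow> 0) at_top"
      unfolding ennreal_0[symmetric]
      by (intro tendsto_ennrealI tendsto_divide_0[OF tendsto_const]
          filterlim_at_top_imp_at_infinity ln_at_top)
    show "eventually (\<lambda>t::real. (SUP k. \<integral>\<^sup>+x. RN_deriv (nu \<Phi> enum 0) (nu \<Phi> enum k) x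
        * indicator {x. ennreal t < RN_deriv (nu \<Phi> enum 0) (nu \<Phi> enum k) x} x \<partial>(nu \<Phi> enum 0))
      \<le> ennreal ((2 * R + 1) / ln t)) at_top"
      using eventually_gt_at_top[of 1] by eventually_elim (intro SUP_least tail)
  qed simp
qed

end
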